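(* Let $K\ge 1$ and let $f\in\mathcal{S}_H^{0}(K,\Omega)$, where $\Omega=f(\mathbb{D})$ is a radial John disk (with respect to $f$). Then there are constants $\delta\in(0,1)$ and $C>0$ such that for all $z\in\mathbb{D}$ and all $\zeta_1,\zeta_2\in B(z)$, $$|f(\zeta_1)-f(\zeta_2)|\le C\,d_\Omega(f(z))\left(\frac{|\zeta_1-\zeta_2|}{1-|z|}\right)^{\delta}.$$
   Context: $\mathbb{D}$ is the open unit disk in $\mathbb{C}$. For a domain $\Omega\subset\mathbb{C}$ and $w\in\Omega$, $d_\Omega(w)$ is the Euclidean distance from $w$ to $\partial\Omega$. For $z\in\mathbb{D}$, $B(z)=\{\zeta:\ |z|\le|\zeta|<1,\ |\arg z-\arg\zeta|\le\pi(1-|z|)\}$, where the difference of arguments is understood modulo $2\pi$ (the representative in $[-\pi,\pi]$), and $B(0)=\mathbb{D}$. $\mathcal{S}_H$ is the family of sense-preserving harmonic univalent mappings $f=h+\overline{g}$ of $\mathbb{D}$ with $h,g$ analytic in $\mathbb{D}$ and $h(0)=g(0)=h'(0)-1=0$; sense-preserving means $J_f=|h'|^2-|g'|^2>0$ in $\mathbb{D}$. $\mathcal{S}_H^0=\{f\in\mathcal{S}_H: g'(0)=0\}$. For $K\ge1$, a sense-preserving homeomorphism $f$ of a domain, of Sobolev class $W^{1,2}_{loc}$, is $K$-quasiconformal if $\|D_f(z)\|^2\le K|\det D_f(z)|$, i.e. $\|D_f(z)\|\le K\,l(D_f(z))$, where $\|D_f\|=|f_z|+|f_{\bar z}|$ and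 $l(D_f)=\big||f_z|-|f_{\bar z}|\big|$. $\mathcal{S}_H^0(K,\Omega)$ is the set of $f\in\mathcal{S}_H^0$ that are $K$-quasiconformal and map $\mathbb{D}$ onto the domain $\Omega\subset\mathbb{C}$. Radial John disk: let $f$ be a complex-valued univalent mapping of $\mathbb{D}$ and let $G=f(\mathbb{D})$ be a bounded simply connected domain. $G$ is a radial $c$-John disk ($c\ge1$) if for every $z\in\mathbb{D}$ the arc $\gamma=f([0,z])$, joining $w_1=f(z)$ to the John center $w_0=f(0)$, is rectifiable and satisfies: for every $w$ on $\gamma$, the Euclidean length of the subarc $\gamma[w_1,w]$ of $\gamma$ between $w_1$ and $w$ is at most $c\,d_G(w)$. $G$ is a radial John disk if it is a radial $c$-John disk for some $c\ge1$. *)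

theory Defs
  imports "HOL-Complex_Analysis.Complex_Analysis"
begin

abbreviation unit_disk :: "complex set" where
  "unit_disk \<equiv> ball 0 1"

definition bdist :: "complex set \<Rightarrow> complex \<Rightarrow> real" where
  "bdist \<Omega> w = infdist w (frontier \<Omega>)"

text \<open>In the non-degenerate case, \<open>\<theta>\<close> is the representative in \<open>[-\<pi>, \<pi>]\<close> of the difference of
  arguments modulo \<open>2\<pi>\<close>. Here \<open>\<zeta>\<close> is automatically nonzero, because \<open>0 < |z| \<le> |\<zeta>|\<close>.\<close>

definition Bset :: "complex \<Rightarrow> complex set" where
  "Bset z = (if z = 0 then unit_disk
     else {\<zeta>. norm z \<le> norm \<zeta> \<and> norm \<zeta> < 1 \<and>
               (\<exists>\<theta>\<in>{-pi..pi}. \<exists>k::int. Arg z - Arg \<zeta> = \<theta> + 2 * pi * of_int k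
                   \<and> \<bar>\<theta>\<bar> \<le> pi * (1 - norm z))})"


section \<open>Harmonic univalent mappings\<close>

text \<open>Only the values of \<open>f\<close> on the unit disk matter.\<close>

definition harmonic_univalent_rep ::
    "(complex \<Rightarrow> complex) \<Rightarrow> (complex \<Rightarrow> complex) \<Rightarrow> (complex \<Rightarrow> complex) \<Rightarrow> bool" where
  "harmonic_univalent_rep f h g \<longleftrightarrow>
     h holomorphic_on unit_disk \<and> g holomorphic_on unit_disk \<and>
     (\<forall>z\<in>unit_disk. f z = h z + cnj (g z)) \<and>
     h 0 = 0 \<and> g 0 = 0 \<and> deriv h 0 - 1 = 0 \<and>
     inj_on f unit_disk \<and>
     (\<forall>z\<in>unit_disk. (norm (deriv h z))\<^sup>2 - (norm (deriv g z))\<^sup>2 > 0)"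

definition S_H :: "(complex \<Rightarrow> complex) set" where
  "S_H = {f. \<exists>h g. harmonic_univalent_rep f h g}"

text \<open>The functions \<open>h\<close> and \<open>g\<close> are determined on the disk by \<open>f\<close>, so the existential
  quantifier below speaks about the same \<open>g\<close> as the one in \<open>S_H\<close>.\<close>

definition S_H0 :: "(complex \<Rightarrow> complex) set" where
  "S_H0 = {f. \<exists>h g. harmonic_univalent_rep f h g \<and> deriv g 0 = 0}"


section \<open>Quasiconformal mappings\<close>

definition dx :: "(complex \<Rightarrow> complex) \<Rightarrow> complex \<Rightarrow> complex" where
  "dx f z = frechet_derivative f (at z) 1"

definition dy :: "(complex \<Rightarrow> complex) \<Rightarrow> complex \<Rightarrow> complex" where
  "dy f z = frechet_derivative f (at z) \<i>"

definition dz :: "(complex \<Rightarrow> complex) \<Rightarrow> complex \<Rightarrow> complex" where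
  "dz f z = (dx f z - \<i> * dy f z) / 2"

definition dzbar :: "(complex \<Rightarrow> complex) \<Rightarrow> complex \<Rightarrow> complex" where
  "dzbar f z = (dx f z + \<i> * dy f z) / 2"

definition D_norm :: "(complex \<Rightarrow> complex) \<Rightarrow> complex \<Rightarrow> real" where
  "D_norm f z = norm (dz f z) + norm (dzbar f z)"

definition D_det :: "(complex \<Rightarrow> complex) \<Rightarrow> complex \<Rightarrow> real" where
  "D_det f z = Re (dx f z) * Im (dy f z) - Re (dy f z) * Im (dx f z)"

definition test_function :: "complex set \<Rightarrow> (complex \<Rightarrow> real) \<Rightarrow> bool" where
  "test_function U \<phi> \<longleftrightarrow>
     (\<forall>z. \<phi> differentiable (at z)) \<and>
     (\<forall>e. continuous_on UNIV (\<lambda>z. frechet_derivative \<phi> (at z) e)) \<and>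
     (\<exists>S. compact S \<and> S \<subseteq> U \<and> (\<forall>z. z \<notin> S \<longrightarrow> \<phi> z = 0))"

definition L2_loc :: "complex set \<Rightarrow> (complex \<Rightarrow> complex) \<Rightarrow> bool" where
  "L2_loc U u \<longleftrightarrow> (\<forall>S. compact S \<and> S \<subseteq> U \<longrightarrow>
     set_borel_measurable lebesgue S u \<and> set_integrable lebesgue S (\<lambda>z. (norm (u z))\<^sup>2))"

text \<open>Test functions of class \<open>C\<^sup>1\<close> with compact support define the same weak derivatives
  of locally integrable functions as smooth ones, by mollification.\<close>

definition weak_derivative ::
    "complex set \<Rightarrow> complex \<Rightarrow> (complex \<Rightarrow> complex) \<Rightarrow> (complex \<Rightarrow> complex) \<Rightarrow> bool" where
  "weak_derivative U e f u \<longleftrightarrow> (\<forall>\<phi>. test_function U \<phi> \<longrightarrow>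
     (LINT z:U|lebesgue. frechet_derivative \<phi> (at z) e *\<^sub>R f z)
       = - (LINT z:U|lebesgue. \<phi> z *\<^sub>R u z))"

definition W12_loc :: "complex set \<Rightarrow> (complex \<Rightarrow> complex) \<Rightarrow> bool" where
  "W12_loc U f \<longleftrightarrow> L2_loc U f \<and>
     (\<exists>u. L2_loc U u \<and> weak_derivative U 1 f u) \<and>
     (\<exists>v. L2_loc U v \<and> weak_derivative U \<i> f v)"

text \<open>A homeomorphism preserves the sense if small positively oriented circles about any point
  \<open>z\<close> are mapped to Jordan curves winding once, positively, around the image of \<open>z\<close>.\<close>

definition sense_preserving_homeo :: "complex set \<Rightarrow> (complex \<Rightarrow> complex) \<Rightarrow> bool" where
  "sense_preserving_homeo U f \<longleftrightarrow>
     (\<exists>g. homeomorphism U (f ` U) f g) \<and>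
     (\<forall>z r. 0 < r \<and> cball z r \<subseteq> U \<longrightarrow> winding_number (f \<circ> circlepath z r) (f z) = 1)"

text \<open>A planar homeomorphism in \<open>W\<^sup>1\<^sup>,\<^sup>2\<^sub>l\<^sub>o\<^sub>c\<close> is differentiable almost everywhere
  (Gehring--Lehto) and its weak partial derivatives agree almost everywhere with the classical
  ones, so the distortion inequality is stated with the classical differential.\<close>

definition quasiconformal_on :: "real \<Rightarrow> complex set \<Rightarrow> (complex \<Rightarrow> complex) \<Rightarrow> bool" where
  "quasiconformal_on K U f \<longleftrightarrow>
     1 \<le> K \<and> open U \<and> connected U \<and> sense_preserving_homeo U f \<and> W12_loc U f \<and>
     (AE z in lebesgue. z \<in> U \<longrightarrow>
        f differentiable (at z) \<and> (D_norm f z)\<^sup>2 \<le> K * \<bar>D_det f z\<bar>)"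

definition S_H0_qc :: "real \<Rightarrow> complex set \<Rightarrow> (complex \<Rightarrow> complex) set" where
  "S_H0_qc K \<Omega> = {f \<in> S_H0. quasiconformal_on K unit_disk f \<and>
                             open \<Omega> \<and> connected \<Omega> \<and> f ` unit_disk = \<Omega>}"


section \<open>Radial John disks\<close>

text \<open>The supremum of the lengths of inscribed polygons.\<close>

definition path_length :: "(real \<Rightarrow> complex) \<Rightarrow> ennreal" where
  "path_length \<gamma> = (SUP (n, t) \<in> {(n::nat, t::nat \<Rightarrow> real). mono t \<and> range t \<subseteq> {0..1}}.
     ennreal (\<Sum>k<n. dist (\<gamma> (t k)) (\<gamma> (t (Suc k)))))"

definition rectifiable_path :: "(real \<Rightarrow> complex) \<Rightarrow> bool" where
  "rectifiable_path \<gamma> \<longleftrightarrow> path \<gamma> \<and> path_length \<gamma> < \<infinity>"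

text \<open>The arc \<open>f([0,z])\<close> is parametrized from \<open>f(0)\<close> to \<open>f(z)\<close>; its subarc between \<open>\<gamma> s\<close> and
  the end point \<open>f(z)\<close> is the restriction of the parametrization to \<open>[s,1]\<close>.\<close>

definition radial_c_John_disk :: "real \<Rightarrow> (complex \<Rightarrow> complex) \<Rightarrow> complex set \<Rightarrow> bool" where
  "radial_c_John_disk c f G \<longleftrightarrow>
     1 \<le> c \<and> inj_on f unit_disk \<and> G = f ` unit_disk \<and>
     open G \<and> bounded G \<and> simply_connected G \<and>
     (\<forall>z\<in>unit_disk. let \<gamma> = f \<circ> linepath 0 z in
        rectifiable_path \<gamma> \<and>
        (\<forall>s\<in>{0..1}. path_length (subpath s 1 \<gamma>) \<le> ennreal (c * bdist G (\<gamma> s))))"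

definition radial_John_disk :: "(complex \<Rightarrow> complex) \<Rightarrow> complex set \<Rightarrow> bool" where
  "radial_John_disk f G \<longleftrightarrow> (\<exists>c\<ge>1. radial_c_John_disk c f G)"

end

theory Submission
  imports Defs
begin

text \<open>
  Write \<open>f = h + cnj g\<close>, \<open>\<lambda> z = |h' z|\<close> and let \<open>d z\<close> be the distance from \<open>f z\<close> to the
  boundary of \<open>\<Omega>\<close>. Quasiconformality says \<open>|g'| \<le> k |h'|\<close> with \<open>k < 1\<close>. The proof compares \<open>d z\<close> with
  \<open>(1 - |z|) \<lambda> z\<close> and then feeds this comparison into the John condition.

  Lower bound. If \<open>h''/h'\<close> grew faster than \<open>1/(1 - |z|)\<close>, then near a point where
  \<open>(r - |z|) |h''/h'|\<close> is maximal, and at the scale \<open>1/|a|\<close> with \<open>a = h''/h'\<close>, Cauchy's estimates would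
  make \<open>h''/h'\<close> and \<open>g'/h'\<close> nearly constant. There \<open>f\<close> would be close to a nondegenerate real-linear image
  of \<open>exp (a z)\<close>, which has the period \<open>2 \<pi> \<i> / a\<close>, so \<open>f\<close> could not be injective
  (\<open>not_inj_if_nearly_exponential\<close>, \<open>pre_Schwarzian_bounded\<close>). Hence \<open>h'\<close> is
  nearly constant on disks of radius \<open>\<eta> (1 - |z|)\<close>, \<open>f\<close> is bi-Lipschitz there with constants
  comparable to \<open>\<lambda> z\<close> (\<open>Whitney_distortion\<close>), and \<open>(1 - |z|) \<lambda> z\<close> is at most a multiple of \<open>d z\<close>. This
  replaces the compactness or modulus arguments behind the usual Koebe-type theorem.

  Upper bound. Along a segment in \<open>\<Omega>\<close> the analytic part \<open>h\<close> moves by at least half of what \<open>f\<close> does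
  (\<open>analytic_part_expands\<close>), so the Schwarz-Pick argument applied to \<open>h\<close> on the preimage of
  the disk of radius \<open>d z\<close> about \<open>f z\<close> gives \<open>d z \<le> 2 (1 - |z|\<^sup>2) \<lambda> z\<close> (\<open>image_ball_radius_le\<close>).

  Conclusion. On a radius divided so that \<open>1 - |z|\<close> shrinks by the factor \<open>1 - \<eta>\<close> in each step, each step
  moves \<open>f\<close> by at least a multiple of \<open>d\<close> at its start, while by the John condition all steps beyond a
  point have total length at most a multiple of \<open>d\<close> at that point. So every tail of the sequence of values
  of \<open>d\<close> is dominated by a multiple of its first term, and \<open>d\<close> decays like a power of \<open>1 - |z|\<close>
  (\<open>radial_decay\<close>). To compare two points of \<open>B(z)\<close> at distance \<open>s\<close>, both are pulled back radially to
  modulus at most \<open>1 - s\<close>, which costs at most a multiple of \<open>d\<close> at modulus \<open>1 - s\<close>, by the John condition again; the pulled-back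
  points are joined by boundedly many steps between neighbouring points of the kind \<open>Whitney_distortion\<close>
  controls (\<open>oscillation_on_Bset\<close>).
\<close>

section \<open>The pre-Schwarzian derivative\<close>

text \<open>
  The image of the open ball is open and its boundary lies in the image of the sphere, so a
  connected set that meets the image and avoids that boundary stays inside.
\<close>

lemma ball_subset_image_ball:
  fixes f :: "complex \<Rightarrow> complex"
  assumes cont: "continuous_on (cball z r) f" and inj: "inj_on f (cball z r)" and "0 < r"
    and far: "\<And>\<zeta>. \<zeta> \<in> sphere z r \<Longrightarrow> m \<le> dist (f z) (f \<zeta>)"
  shows "ball (f z) m \<subseteq> f ` ball z r"
proof (rule ccontr)
  assume not: "\<not> ?thesis"
  then have "0 < m"
    by (metis ball_empty empty_subsetI not_le)
  have op: "open (f ` ball z r)"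
    by (rule invariance_of_domain[OF continuous_on_subset[OF cont] _ inj_on_subset[OF inj]]) auto
  have "ball (f z) m \<inter> f ` ball z r \<noteq> {}"
    using \<open>0 < m\<close> \<open>0 < r\<close> by (metis IntI centre_in_ball empty_iff image_eqI)
  moreover have "ball (f z) m - f ` ball z r \<noteq> {}"
    using not by blast
  ultimately have "ball (f z) m \<inter> frontier (f ` ball z r) \<noteq> {}"
    by (rule connected_Int_frontier[OF connected_ball])
  then obtain w where w: "w \<in> ball (f z) m" "w \<in> frontier (f ` ball z r)"
    by auto
  have "closed (f ` cball z r)"
    by (rule compact_imp_closed[OF compact_continuous_image[OF cont compact_cball]])
  then have "closure (f ` ball z r) \<subseteq> f ` cball z r"
    by (intro closure_minimal image_mono) auto
  with w op have "w \<in> f ` cball z r" "w \<notin> f ` ball z r"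
    by (auto simp: frontier_def interior_open)
  then obtain \<zeta> where "\<zeta> \<in> cball z r - ball z r" "w = f \<zeta>"
    by blast
  then have "\<zeta> \<in> sphere z r" by auto
  then show False using far[of \<zeta>] w(1) \<open>w = f \<zeta>\<close> by simp
qed

lemma Cauchy_lipschitz:
  assumes holo: "\<phi> holomorphic_on ball z R" and bd: "\<And>\<zeta>. \<zeta> \<in> ball z R \<Longrightarrow> norm (\<phi> \<zeta>) \<le> B"
    and "0 < R" and \<zeta>: "\<zeta> \<in> cball z (R/2)"
  shows "norm (\<phi> \<zeta> - \<phi> z) \<le> 4 * B / R * norm (\<zeta> - z)"
proof -
  have 1: "norm (deriv \<phi> x) \<le> 4 * B / R" if x: "x \<in> cball z (R/2)" for x
  proof -
    have sub: "cball x (R/4) \<subseteq> ball z R"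
    proof
      fix y assume "y \<in> cball x (R/4)"
      then show "y \<in> ball z R"
        using x dist_triangle[of z y x] \<open>0 < R\<close> by auto
    qed
    have "norm ((deriv ^^ 1) \<phi> x) \<le> fact 1 * B / (R/4) ^ 1"
    proof (rule Cauchy_inequality)
      show "\<phi> holomorphic_on ball x (R/4)"
        using holo sub by (meson ball_subset_cball holomorphic_on_subset order_trans)
      show "continuous_on (cball x (R/4)) \<phi>"
        using holo sub by (meson holomorphic_on_imp_continuous_on holomorphic_on_subset)
      show "norm (\<phi> y) \<le> B" if "norm (x - y) = R/4" for y
        using bd[of y] sub that by (auto simp: dist_norm subset_iff)
    qed (use \<open>0 < R\<close> in auto)
    then show ?thesis by (simp add: mult.commute)
  qed
  have 2: "(\<phi> has_field_derivative deriv \<phi> x) (at x within cball z (R/2))"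
    if "x \<in> cball z (R/2)" for x
    by (rule has_field_derivative_at_within[OF holomorphic_derivI[OF holo open_ball]])
      (use that \<open>0 < R\<close> in auto)
  show ?thesis
    by (rule field_differentiable_bound[OF convex_cball 2 1 \<zeta>]) (use \<open>0 < R\<close> in auto)
qed

lemma norm_exp_minus_1_le:
  fixes x :: complex
  assumes "norm x \<le> 1"
  shows "norm (exp x - 1) \<le> 3 * norm x"
proof -
  have "norm (exp x - (\<Sum>i\<le>0. x ^ i / fact i)) \<le> exp \<bar>Re x\<bar> * (norm x) ^ Suc 0 / fact 0"
    by (rule Taylor_exp)
  then have "norm (exp x - 1) \<le> exp \<bar>Re x\<bar> * norm x" by simp
  moreover have "exp \<bar>Re x\<bar> \<le> 3"
  proof -
    have "exp \<bar>Re x\<bar> \<le> exp 1" using abs_Re_le_cmod[of x] assms by simp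
    then show ?thesis using e_less_272 by linarith
  qed
  ultimately show ?thesis
    by (meson mult_right_mono norm_ge_zero order_trans)
qed

lemma norm_exp_minus_1_ge:
  fixes x :: complex
  assumes "norm x = 1/2"
  shows "1/16 \<le> norm (exp x - 1)"
proof -
  have "norm (exp x - (\<Sum>i\<le>1. x ^ i / fact i)) \<le> exp \<bar>Re x\<bar> * (norm x) ^ Suc 1 / fact 1"
    by (rule Taylor_exp)
  then have "norm (exp x - 1 - x) \<le> exp \<bar>Re x\<bar> / 4"
    using assms by (simp add: diff_diff_eq power2_eq_square)
  moreover have "exp \<bar>Re x\<bar> \<le> 17/10"
  proof -
    have "exp (1/2::real) ^ 2 = exp 1" by (simp add: exp_double[symmetric])
    also have "\<dots> \<le> (17/10) ^ 2" using e_less_272 by (simp add: power2_eq_square)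
    finally have "exp (1/2::real) \<le> 17/10"
      using power2_le_imp_le by (metis divide_nonneg_nonneg zero_le_numeral)
    moreover have "exp \<bar>Re x\<bar> \<le> exp (1/2)" using abs_Re_le_cmod[of x] assms by simp
    ultimately show ?thesis by linarith
  qed
  moreover have "norm x \<le> norm (exp x - 1) + norm (exp x - 1 - x)"
    by (metis add.commute diff_add_cancel norm_minus_commute norm_triangle_sub)
  ultimately show ?thesis using assms by linarith
qed

text \<open>
  With \<open>b = exp (L z0)\<close> and \<open>P \<zeta> = (b / a) (exp (a (\<zeta> - z0)) - 1)\<close>, the map \<open>f - f z0\<close> is close to
  \<open>P + cnj (c P)\<close>. The latter vanishes at \<open>z0\<close> and at \<open>z0 + 2 \<pi> \<i> / a\<close>, while it is bounded away from
  \<open>0\<close> on the circle of radius \<open>1 / (2 |a|)\<close> about \<open>z0\<close>. So \<open>f\<close> takes the value \<open>f (z0 + 2 \<pi> \<i> / a)\<close> once more,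
  inside that circle.
\<close>

lemma not_inj_if_nearly_exponential:
  fixes f h g L :: "complex \<Rightarrow> complex" and a c z0 :: complex and k \<epsilon> :: real
  defines "R \<equiv> 8 / norm a"
  assumes a: "a \<noteq> 0"
    and h: "h holomorphic_on ball z0 R" and g: "g holomorphic_on ball z0 R"
    and f: "\<And>\<zeta>. \<zeta> \<in> ball z0 R \<Longrightarrow> f \<zeta> = h \<zeta> + cnj (g \<zeta>)"
    and L: "\<And>\<zeta>. \<zeta> \<in> ball z0 R \<Longrightarrow> deriv h \<zeta> = exp (L \<zeta>)"
    and L_affine: "\<And>\<zeta>. \<zeta> \<in> ball z0 R \<Longrightarrow> norm (L \<zeta> - L z0 - a * (\<zeta> - z0)) \<le> \<epsilon>"
    and dil: "\<And>\<zeta>. \<zeta> \<in> ball z0 R \<Longrightarrow> norm (deriv g \<zeta> - c * deriv h \<zeta>) \<le> \<epsilon> * norm (deriv h \<zeta>)"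
    and c: "norm c \<le> k" and k: "k < 1"
    and \<epsilon>: "\<epsilon> \<le> 1" "2560 * exp 8 * \<epsilon> < 1 - k"
  shows "\<not> inj_on f (ball z0 R)"
proof
  assume inj: "inj_on f (ball z0 R)"
  define b where "b = exp (L z0)"
  define P where "P \<zeta> = b / a * (exp (a * (\<zeta> - z0)) - 1)" for \<zeta>
  define s where "s = norm b / norm a"
  have R: "0 < R" using a by (simp add: R_def)
  have s: "0 < s" using a by (simp add: s_def b_def)
  have eps0: "0 \<le> \<epsilon>" using L_affine[of z0] R by auto
  \<comment> \<open>On the ball \<open>|a (\<zeta> - z0)| \<le> 8\<close>; the radius \<open>8 / |a|\<close> exceeds \<open>2 \<pi> / |a|\<close>.\<close>
  have hd: "norm (deriv h \<zeta> - b * exp (a * (\<zeta> - z0))) \<le> 3 * exp 8 * \<epsilon> * norm b"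
    and hn: "norm (deriv h \<zeta>) \<le> 4 * exp 8 * norm b" if "\<zeta> \<in> ball z0 R" for \<zeta>
  proof -
    let ?x = "L \<zeta> - L z0 - a * (\<zeta> - z0)"
    have x: "norm ?x \<le> \<epsilon>" using L_affine that .
    have "norm (a * (\<zeta> - z0)) \<le> 8"
      unfolding norm_mult
      using that a by (simp add: R_def dist_norm norm_minus_commute pos_less_divide_eq mult.commute)
    then have "Re (a * (\<zeta> - z0)) \<le> 8"
      using complex_Re_le_cmod[of "a * (\<zeta> - z0)"] by linarith
    then have E: "norm (exp (a * (\<zeta> - z0))) \<le> exp 8" by simp
    have h_eq: "deriv h \<zeta> = b * exp (a * (\<zeta> - z0)) * exp ?x"
      using L that by (simp add: b_def exp_add[symmetric])
    have "norm (exp ?x - 1) \<le> 3 * norm ?x"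
      by (rule norm_exp_minus_1_le) (use x \<epsilon> in linarith)
    then have X: "norm (exp ?x - 1) \<le> 3 * \<epsilon>" using x by linarith
    have "deriv h \<zeta> - b * exp (a * (\<zeta> - z0)) = b * exp (a * (\<zeta> - z0)) * (exp ?x - 1)"
      by (simp add: h_eq algebra_simps)
    then have "norm (deriv h \<zeta> - b * exp (a * (\<zeta> - z0)))
        = norm b * (norm (exp (a * (\<zeta> - z0))) * norm (exp ?x - 1))"
      by (simp only: norm_mult mult.assoc)
    also have "\<dots> \<le> norm b * (exp 8 * (3 * \<epsilon>))"
      by (intro mult_left_mono mult_mono E X) auto
    finally show 1: "norm (deriv h \<zeta> - b * exp (a * (\<zeta> - z0))) \<le> 3 * exp 8 * \<epsilon> * norm b"
      by (simp add: mult_ac)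
    have "norm (exp ?x) \<le> 4"
      using X \<epsilon> norm_triangle_sub[of "exp ?x" 1] by simp
    then have "norm (deriv h \<zeta>) \<le> norm b * (exp 8 * 4)"
      unfolding h_eq norm_mult mult.assoc by (intro mult_left_mono mult_mono E) auto
    then show "norm (deriv h \<zeta>) \<le> 4 * exp 8 * norm b" by (simp add: mult_ac)
  qed
  have gd: "norm (deriv g \<zeta> - c * (b * exp (a * (\<zeta> - z0)))) \<le> 7 * exp 8 * \<epsilon> * norm b"
    if "\<zeta> \<in> ball z0 R" for \<zeta>
  proof -
    have "norm (deriv g \<zeta> - c * (b * exp (a * (\<zeta> - z0))))
       \<le> norm (deriv g \<zeta> - c * deriv h \<zeta>) + norm (c * (deriv h \<zeta> - b * exp (a * (\<zeta> - z0))))"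
      by (rule order_trans[OF _ norm_triangle_ineq]) (simp add: algebra_simps)
    also have "\<dots> \<le> \<epsilon> * (4 * exp 8 * norm b) + 1 * (3 * exp 8 * \<epsilon> * norm b)"
    proof (rule add_mono)
      show "norm (deriv g \<zeta> - c * deriv h \<zeta>) \<le> \<epsilon> * (4 * exp 8 * norm b)"
        using dil[OF that] mult_left_mono[OF hn[OF that] eps0] by linarith
      show "norm (c * (deriv h \<zeta> - b * exp (a * (\<zeta> - z0)))) \<le> 1 * (3 * exp 8 * \<epsilon> * norm b)"
        unfolding norm_mult using c k by (intro mult_mono hd that) auto
    qed
    finally show ?thesis by (simp add: algebra_simps)
  qed
  have P': "(P has_field_derivative b * exp (a * (\<zeta> - z0))) (at \<zeta>)" for \<zeta>
    unfolding P_def using a by (auto intro!: derivative_eq_intros)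
  have P0: "P z0 = 0" by (simp add: P_def)
  have he: "norm (h \<zeta> - h z0 - P \<zeta>) \<le> 24 * exp 8 * \<epsilon> * s"
    and ge: "norm (g \<zeta> - g z0 - c * P \<zeta>) \<le> 56 * exp 8 * \<epsilon> * s" if \<zeta>: "\<zeta> \<in> ball z0 R" for \<zeta>
  proof -
    have t: "norm (\<zeta> - z0) \<le> 8 / norm a"
      using \<zeta> by (simp add: R_def dist_norm norm_minus_commute)
    have "norm ((h \<zeta> - P \<zeta>) - (h z0 - P z0)) \<le> 3 * exp 8 * \<epsilon> * norm b * norm (\<zeta> - z0)"
      by (rule field_differentiable_bound[OF convex_ball, of z0 R _
            "\<lambda>\<zeta>. deriv h \<zeta> - b * exp (a * (\<zeta> - z0))"])
         (use \<zeta> R hd in \<open>auto intro!: derivative_eq_intros has_field_derivative_at_within[OF P']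
             has_field_derivative_at_within[OF holomorphic_derivI[OF h open_ball]]\<close>)
    also have "\<dots> \<le> 3 * exp 8 * \<epsilon> * norm b * (8 / norm a)"
      using eps0 by (intro mult_left_mono t) auto
    finally show "norm (h \<zeta> - h z0 - P \<zeta>) \<le> 24 * exp 8 * \<epsilon> * s"
      by (simp add: P0 s_def algebra_simps)
    have "norm ((g \<zeta> - c * P \<zeta>) - (g z0 - c * P z0)) \<le> 7 * exp 8 * \<epsilon> * norm b * norm (\<zeta> - z0)"
      by (rule field_differentiable_bound[OF convex_ball, of z0 R _
            "\<lambda>\<zeta>. deriv g \<zeta> - c * (b * exp (a * (\<zeta> - z0)))"])
         (use \<zeta> R gd in \<open>auto intro!: derivative_eq_intros has_field_derivative_at_within[OF P']
             has_field_derivative_at_within[OF holomorphic_derivI[OF g open_ball]]\<close>)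
    also have "\<dots> \<le> 7 * exp 8 * \<epsilon> * norm b * (8 / norm a)"
      using eps0 by (intro mult_left_mono t) auto
    finally show "norm (g \<zeta> - g z0 - c * P \<zeta>) \<le> 56 * exp 8 * \<epsilon> * s"
      by (simp add: P0 s_def algebra_simps)
  qed
  have err: "norm (f \<zeta> - f z0 - (P \<zeta> + cnj (c * P \<zeta>))) \<le> 80 * exp 8 * \<epsilon> * s"
    if "\<zeta> \<in> ball z0 R" for \<zeta>
  proof -
    have "f \<zeta> - f z0 - (P \<zeta> + cnj (c * P \<zeta>))
        = (h \<zeta> - h z0 - P \<zeta>) + cnj (g \<zeta> - g z0 - c * P \<zeta>)"
      using f that R by (simp add: algebra_simps)
    then have "norm (f \<zeta> - f z0 - (P \<zeta> + cnj (c * P \<zeta>)))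
        \<le> norm (h \<zeta> - h z0 - P \<zeta>) + norm (g \<zeta> - g z0 - c * P \<zeta>)"
      by (metis complex_mod_cnj norm_triangle_ineq)
    then show ?thesis using he[OF that] ge[OF that] by linarith
  qed
  have small: "80 * exp 8 * \<epsilon> * s < (1 - k) / 32 * s"
    using \<epsilon>(2) s by (intro mult_strict_right_mono) auto
  let ?r = "1 / (2 * norm a)"
  have sub: "cball z0 ?r \<subseteq> ball z0 R"
    using a by (auto simp: R_def field_simps)
  have "ball (f z0) ((1 - k) / 32 * s) \<subseteq> f ` ball z0 ?r"
  proof (rule ball_subset_image_ball)
    have "continuous_on (ball z0 R) (\<lambda>\<zeta>. h \<zeta> + cnj (g \<zeta>))"
      by (intro continuous_intros holomorphic_on_imp_continuous_on h g)
    then have "continuous_on (ball z0 R) f"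
      by (rule continuous_on_cong[THEN iffD1, rotated -1]) (auto simp: f)
    then show "continuous_on (cball z0 ?r) f" using sub continuous_on_subset by blast
    show "inj_on f (cball z0 ?r)" using inj sub inj_on_subset by blast
    show "0 < ?r" using a by simp
    fix \<zeta> assume "\<zeta> \<in> sphere z0 ?r"
    then have \<zeta>: "\<zeta> \<in> ball z0 R" "norm (a * (\<zeta> - z0)) = 1/2"
      using a by (auto simp: R_def norm_mult dist_norm norm_minus_commute divide_simps mult_ac)
    have "1/16 * s \<le> norm (P \<zeta>)"
      using mult_left_mono[OF norm_exp_minus_1_ge[OF \<zeta>(2)], of s] s
      by (simp add: P_def norm_mult norm_divide s_def)
    then have "(1 - k) * (1/16 * s) \<le> (1 - k) * norm (P \<zeta>)"
      using k by (intro mult_left_mono) auto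
    also have "\<dots> \<le> norm (P \<zeta>) - norm (cnj (c * P \<zeta>))"
      using mult_right_mono[OF c, of "norm (P \<zeta>)"] by (simp add: norm_mult algebra_simps)
    also have "\<dots> \<le> norm (P \<zeta> + cnj (c * P \<zeta>))"
      by (metis norm_diff_ineq)
    finally have "(1 - k) / 16 * s \<le> norm (P \<zeta> + cnj (c * P \<zeta>))" by simp
    moreover have "norm (P \<zeta> + cnj (c * P \<zeta>)) \<le> norm (f \<zeta> - f z0)
        + norm (f \<zeta> - f z0 - (P \<zeta> + cnj (c * P \<zeta>)))"
      by (metis norm_minus_commute norm_triangle_sub add.commute)
    ultimately show "(1 - k) / 32 * s \<le> dist (f z0) (f \<zeta>)"
      using err[OF \<zeta>(1)] small by (simp add: dist_norm norm_minus_commute field_simps)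
  qed
  moreover define p where "p = z0 + 2 * of_real pi * \<i> / a"
  have dp: "dist z0 p = 2 * pi / norm a" by (simp add: p_def dist_norm norm_mult norm_divide)
  have p: "p \<in> ball z0 R"
    using pi_less_4 a by (simp add: dp R_def divide_strict_right_mono)
  have "P p = 0" using a by (simp add: P_def p_def)
  then have "norm (f p - f z0) < (1 - k) / 32 * s" using err[OF p] small by simp
  then have "f p \<in> ball (f z0) ((1 - k) / 32 * s)" by (simp add: dist_norm norm_minus_commute)
  ultimately obtain q where q: "q \<in> ball z0 ?r" "f q = f p" by (metis imageE subsetD)
  then have "q = p" using inj p sub by (meson ball_subset_cball inj_onD subsetD)
  then have "2 * pi / norm a < 1 / (2 * norm a)" using q dp by simp
  moreover have "1 / (2 * norm a) < 2 * pi / norm a"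
    using a pi_gt3 by (simp add: field_simps)
  ultimately show False by linarith
qed

lemma has_derivative_harmonic:
  assumes "h holomorphic_on unit_disk" "g holomorphic_on unit_disk"
    and f: "\<And>z. z \<in> unit_disk \<Longrightarrow> f z = h z + cnj (g z)" and z: "z \<in> unit_disk"
  shows "(f has_derivative (\<lambda>v. deriv h z * v + cnj (deriv g z * v))) (at z)"
proof -
  have "(h has_derivative (\<lambda>v. deriv h z * v)) (at z)" "(g has_derivative (\<lambda>v. deriv g z * v)) (at z)"
    using holomorphic_derivI[OF assms(1) open_ball z] holomorphic_derivI[OF assms(2) open_ball z]
    by (auto simp: has_field_derivative_def)
  then have "((\<lambda>x. h x + cnj (g x)) has_derivative (\<lambda>v. deriv h z * v + cnj (deriv g z * v))) (at z)"
    by (intro derivative_intros) auto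
  then show ?thesis
    by (rule has_derivative_transform_within_open[OF _ open_ball z]) (simp add: f)
qed

locale harmonic_qc_disk =
  fixes f h g :: "complex \<Rightarrow> complex" and k :: real
  assumes holo_h: "h holomorphic_on unit_disk" and holo_g: "g holomorphic_on unit_disk"
    and f_eq: "\<And>z. z \<in> unit_disk \<Longrightarrow> f z = h z + cnj (g z)"
    and inj: "inj_on f unit_disk"
    and deriv_h_nonzero: "\<And>z. z \<in> unit_disk \<Longrightarrow> deriv h z \<noteq> 0"
    and dilatation: "\<And>z. z \<in> unit_disk \<Longrightarrow> norm (deriv g z) \<le> k * norm (deriv h z)"
    and k_nonneg: "0 \<le> k" and k_less_1: "k < 1"
begin

lemma continuous_f: "continuous_on unit_disk f"
proof -
  have "continuous_on unit_disk (\<lambda>z. h z + cnj (g z))"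
    by (intro continuous_intros holomorphic_on_imp_continuous_on holo_h holo_g)
  then show ?thesis by (rule continuous_on_cong[THEN iffD1, rotated -1]) (auto simp: f_eq)
qed

text \<open>
  The bound is the one for the logarithm \<open>L\<close> of \<open>h'\<close>, whose derivative is \<open>N = h''/h'\<close>. If it failed, one
  could choose \<open>r < 1\<close> and a maximum point \<open>z0\<close> of \<open>(r - |z|) |N z|\<close> with a large maximum \<open>M\<close>. Maximality bounds
  \<open>|N|\<close> by \<open>2 |N z0|\<close> on the disk of radius \<open>(r - |z0|) / 2\<close>, which is \<open>M / 16\<close> times as large as \<open>8 / |N z0|\<close>.
  By Cauchy's estimates \<open>N\<close> and \<open>g'/h'\<close> are then nearly constant on the disk of radius
  \<open>8 / |N z0|\<close>, and \<open>f\<close> cannot be injective there.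
\<close>

lemma pre_Schwarzian_bounded:
  obtains L \<beta> where "L holomorphic_on unit_disk" "\<And>z. z \<in> unit_disk \<Longrightarrow> exp (L z) = deriv h z"
    "0 < \<beta>" "\<And>z. z \<in> unit_disk \<Longrightarrow> (1 - norm z) * norm (deriv L z) \<le> \<beta>"
proof -
  have "deriv h holomorphic_on unit_disk"
    by (intro holomorphic_deriv holo_h) auto
  then obtain L where L: "L holomorphic_on unit_disk" "\<And>z. z \<in> unit_disk \<Longrightarrow> exp (L z) = deriv h z"
    by (rule holomorphic_logarithm_exists[OF convex_ball open_ball, of "deriv h" 0 1 0])
      (use deriv_h_nonzero in auto)
  define N where "N = deriv L"
  define \<omega> where "\<omega> z = deriv g z / deriv h z" for z
  have holo_N: "N holomorphic_on unit_disk"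
    unfolding N_def by (intro holomorphic_deriv L) auto
  have holo_\<omega>: "\<omega> holomorphic_on unit_disk"
    unfolding \<omega>_def using deriv_h_nonzero
    by (intro holomorphic_on_divide holomorphic_deriv holo_h holo_g) auto
  have \<omega>_le: "norm (\<omega> z) \<le> k" if "z \<in> unit_disk" for z
    using dilatation[OF that] deriv_h_nonzero[OF that]
    by (simp add: \<omega>_def norm_divide pos_divide_le_eq)
  \<comment> \<open>The deviations below are at most \<open>\<epsilon> = 1024 / M\<close>; they must satisfy \<open>2560 e\<^sup>8 \<epsilon> < 1 - k\<close>.\<close>
  define M0 where "M0 = 2621440 * exp 8 / (1 - k)"
  have "1 \<le> exp (8::real) / (1 - k)"
    using k_less_1 k_nonneg one_le_exp_iff[of "8::real"]
    by (simp add: le_divide_eq del: one_le_exp_iff)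
  then have M0: "1024 \<le> M0" by (simp add: M0_def)
  have "(1 - norm z) * norm (N z) \<le> M0" if z: "z \<in> unit_disk" for z
  proof (rule ccontr)
    assume "\<not> ?thesis"
    then have big: "M0 < (1 - norm z) * norm (N z)" by simp
    then have "N z \<noteq> 0" using M0 by auto
    then have "norm z + M0 / norm (N z) < 1" using big by (simp add: field_simps)
    then obtain r where r: "norm z + M0 / norm (N z) < r" "r < 1" using dense by blast
    then have r': "M0 < (r - norm z) * norm (N z)" using \<open>N z \<noteq> 0\<close> by (simp add: field_simps)
    have zr: "norm z \<le> r" using r M0 by (smt (verit) divide_nonneg_nonneg norm_ge_zero)
    have sub_r: "cball 0 r \<subseteq> unit_disk" using r by auto
    have "continuous_on (cball 0 r) (\<lambda>x. (r - norm x) * norm (N x))"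
      by (intro continuous_intros continuous_on_subset[OF holomorphic_on_imp_continuous_on[OF holo_N] sub_r])
    then obtain z0 where z0: "z0 \<in> cball 0 r"
      and max: "\<And>x. x \<in> cball 0 r \<Longrightarrow> (r - norm x) * norm (N x) \<le> (r - norm z0) * norm (N z0)"
      using continuous_attains_sup[of "cball 0 r" "\<lambda>x. (r - norm x) * norm (N x)"] zr by fastforce
    define M where "M = (r - norm z0) * norm (N z0)"
    define a where "a = N z0"
    define R1 where "R1 = (r - norm z0) / 2"
    have M: "M0 < M" using r' max[of z] zr by (simp add: M_def)
    have a0: "a \<noteq> 0" using M M0 by (auto simp: M_def a_def)
    have "r - norm z0 \<noteq> 0" using M M0 by (auto simp: M_def)
    then have R1: "0 < R1" using z0 by (simp add: R1_def)
    have aM: "norm a * (2 * R1) = M" by (simp add: M_def a_def R1_def)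
    have R_eq: "8 / norm a = 16 * R1 / M"
      using a0 R1 by (simp add: aM[symmetric])
    have R_le: "8 / norm a \<le> R1 / 2"
      unfolding R_eq using M M0 R1 by (simp add: field_simps)
    have sub: "ball z0 R1 \<subseteq> unit_disk" "ball z0 R1 \<subseteq> cball 0 r"
      and norm_le: "\<And>x. x \<in> ball z0 R1 \<Longrightarrow> R1 \<le> r - norm x"
    proof -
      show *: "R1 \<le> r - norm x" if "x \<in> ball z0 R1" for x
        using that norm_triangle_sub[of x z0] by (simp add: R1_def dist_norm norm_minus_commute)
      show "ball z0 R1 \<subseteq> cball 0 r" using * R1 by fastforce
      then show "ball z0 R1 \<subseteq> unit_disk" using sub_r by blast
    qed
    have N_le: "norm (N x) \<le> 2 * norm a" if "x \<in> ball z0 R1" for x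
    proof -
      have "R1 * norm (N x) \<le> (r - norm x) * norm (N x)"
        by (intro mult_right_mono norm_le that) auto
      also have "\<dots> \<le> M" unfolding M_def using sub(2) that by (intro max) blast
      also have "\<dots> = R1 * (2 * norm a)" by (simp add: aM[symmetric])
      finally show ?thesis using R1 by simp
    qed
    have near: "x \<in> cball z0 (R1/2)" "norm (x - z0) \<le> 16 * R1 / M" if "x \<in> ball z0 (8 / norm a)" for x
      using that R_le R_eq by (auto simp: dist_norm norm_minus_commute)
    have sub8: "ball z0 (8 / norm a) \<subseteq> unit_disk"
    proof (rule order_trans[OF subset_ball sub(1)])
      show "8 / norm a \<le> R1" using R_le R1 by linarith
    qed
    have N_near: "norm (N x - a) \<le> 128 * norm a / M" if "x \<in> ball z0 (8 / norm a)" for x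
    proof -
      have "norm (N x - N z0) \<le> 4 * (2 * norm a) / R1 * norm (x - z0)"
        by (rule Cauchy_lipschitz[OF holomorphic_on_subset[OF holo_N sub(1)] N_le R1 near(1)[OF that]])
      also have "\<dots> \<le> 4 * (2 * norm a) / R1 * (16 * R1 / M)"
        using near(2)[OF that] R1 by (intro mult_left_mono) auto
      also have "\<dots> = 128 * norm a / M" using R1 by simp
      finally show ?thesis by (simp add: a_def)
    qed
    have \<omega>_near: "norm (\<omega> x - \<omega> z0) \<le> 1024 / M" if "x \<in> ball z0 (8 / norm a)" for x
    proof -
      have "norm (\<omega> x - \<omega> z0) \<le> 4 * 1 / R1 * norm (x - z0)"
        by (rule Cauchy_lipschitz[OF holomorphic_on_subset[OF holo_\<omega> sub(1)] _ R1 near(1)[OF that]])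
          (use sub(1) \<omega>_le k_less_1 in force)
      also have "\<dots> \<le> 4 * 1 / R1 * (16 * R1 / M)"
        using near(2)[OF that] R1 by (intro mult_left_mono) auto
      also have "\<dots> = 64 / M" using R1 by simp
      also have "\<dots> \<le> 1024 / M" using M M0 by (intro divide_right_mono) auto
      finally show ?thesis .
    qed
    have "\<not> inj_on f (ball z0 (8 / norm a))"
    proof (rule not_inj_if_nearly_exponential[where h = h and g = g and L = L and k = k
            and c = "\<omega> z0" and \<epsilon> = "1024 / M"])
      show "h holomorphic_on ball z0 (8 / norm a)" "g holomorphic_on ball z0 (8 / norm a)"
        using holo_h holo_g sub8 holomorphic_on_subset by blast+
      show "norm (\<omega> z0) \<le> k" using \<omega>_le z0 sub_r by auto
      show "1024 / M \<le> 1" using M M0 by simp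
      have "2621440 * exp 8 < M * (1 - k)"
        using M k_less_1 by (simp add: M0_def pos_divide_less_eq)
      then show "2560 * exp 8 * (1024 / M) < 1 - k"
        using M M0 by (simp add: field_simps)
      fix x assume x: "x \<in> ball z0 (8 / norm a)"
      then have xD: "x \<in> unit_disk" using sub8 by blast
      show "f x = h x + cnj (g x)" by (rule f_eq[OF xD])
      show "deriv h x = exp (L x)" using L xD by simp
      have "norm ((L x - a * x) - (L z0 - a * z0)) \<le> 128 * norm a / M * norm (x - z0)"
      proof (rule field_differentiable_bound[OF convex_ball, of z0 "8 / norm a" _ "\<lambda>x. N x - a"])
        fix y assume y: "y \<in> ball z0 (8 / norm a)"
        then have "(L has_field_derivative N y) (at y)"
          unfolding N_def using sub8 by (intro holomorphic_derivI[OF L(1)]) auto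
        then have "(L has_field_derivative N y) (at y within ball z0 (8 / norm a))"
          by (rule has_field_derivative_at_within)
        then show "((\<lambda>x. L x - a * x) has_field_derivative N y - a) (at y within ball z0 (8 / norm a))"
          by (auto intro!: derivative_eq_intros)
      qed (use N_near x a0 in auto)
      also have "\<dots> \<le> 128 * norm a / M * (8 / norm a)"
        using x M M0 by (intro mult_left_mono) (auto simp: dist_norm norm_minus_commute)
      also have "\<dots> = 1024 / M" using a0 by simp
      finally show "norm (L x - L z0 - a * (x - z0)) \<le> 1024 / M"
        by (simp add: algebra_simps)
      have "deriv g x - \<omega> z0 * deriv h x = (\<omega> x - \<omega> z0) * deriv h x"
        using deriv_h_nonzero[OF xD] by (simp add: \<omega>_def algebra_simps)
      then show "norm (deriv g x - \<omega> z0 * deriv h x) \<le> 1024 / M * norm (deriv h x)"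
        using mult_right_mono[OF \<omega>_near[OF x] norm_ge_zero[of "deriv h x"]] by (simp add: norm_mult)
    qed (use a0 k_less_1 in auto)
    then show False using inj sub8 inj_on_subset by blast
  qed
  then show thesis using that[OF L, of M0] M0 by (auto simp: N_def)
qed

text \<open>
  For small \<open>\<eta>\<close> the bound on \<open>h''/h'\<close> keeps \<open>h'\<close> within \<open>e |h' z|\<close> of \<open>h' z\<close> on the disk of radius \<open>\<eta> (1 - |z|)\<close>.
  So \<open>h\<close> is nearly linear there, and \<open>g\<close> moves at most about \<open>k\<close> times as much as \<open>h\<close>; the choice
  \<open>e = (1 - k) / 4\<close> leaves half of the gap \<open>1 - k\<close>.
\<close>

lemma Whitney_distortion:
  obtains \<eta> where "0 < \<eta>" "\<eta> \<le> 1/2"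
    "\<And>z \<zeta>. z \<in> unit_disk \<Longrightarrow> norm (\<zeta> - z) \<le> \<eta> * (1 - norm z) \<Longrightarrow>
       norm (f \<zeta> - f z) \<le> 4 * norm (deriv h z) * norm (\<zeta> - z)"
    "\<And>z \<zeta>. z \<in> unit_disk \<Longrightarrow> norm (\<zeta> - z) \<le> \<eta> * (1 - norm z) \<Longrightarrow>
       (1 - k) / 2 * norm (deriv h z) * norm (\<zeta> - z) \<le> norm (f \<zeta> - f z)"
proof -
  obtain L \<beta> where L: "L holomorphic_on unit_disk" "\<And>z. z \<in> unit_disk \<Longrightarrow> exp (L z) = deriv h z"
    and \<beta>: "0 < \<beta>" "\<And>z. z \<in> unit_disk \<Longrightarrow> (1 - norm z) * norm (deriv L z) \<le> \<beta>"
    using pre_Schwarzian_bounded by blast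
  define e where "e = (1 - k) / 4"
  have e: "0 < e" "e \<le> 1/4" using k_less_1 k_nonneg by (auto simp: e_def)
  define \<eta> where "\<eta> = min (1/2) (e / (6 * \<beta>))"
  have \<eta>: "0 < \<eta>" "\<eta> \<le> 1/2" "\<eta> \<le> e / (6 * \<beta>)" using e \<beta> by (auto simp: \<eta>_def)
  then have \<eta>\<beta>: "6 * \<beta> * \<eta> \<le> e" using \<beta> by (simp add: field_simps)
  have est: "norm (f \<zeta> - f z) \<le> 4 * norm (deriv h z) * norm (\<zeta> - z) \<and>
      (1 - k) / 2 * norm (deriv h z) * norm (\<zeta> - z) \<le> norm (f \<zeta> - f z)"
    if z: "z \<in> unit_disk" and \<zeta>: "norm (\<zeta> - z) \<le> \<eta> * (1 - norm z)" for z \<zeta>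
  proof -
    define \<rho> where "\<rho> = \<eta> * (1 - norm z)"
    define l where "l = norm (deriv h z)"
    have half: "\<rho> \<le> (1 - norm z) / 2" using \<eta> z mult_right_mono[of \<eta> "1/2" "1 - norm z"] by (auto simp: \<rho>_def)
    have \<rho>0: "0 < \<rho>" using \<eta> z by (simp add: \<rho>_def)
    have in_disk: "(1 - norm z) / 2 \<le> 1 - norm x" "x \<in> unit_disk" if "x \<in> cball z \<rho>" for x
    proof -
      show *: "(1 - norm z) / 2 \<le> 1 - norm x"
        using that half norm_triangle_sub[of x z] by (simp add: dist_norm norm_minus_commute)
      show "x \<in> unit_disk" using * z by simp
    qed
    have L_le: "norm (deriv L x) \<le> 2 * \<beta> / (1 - norm z)" if "x \<in> cball z \<rho>" for x
    proof -
      have "(1 - norm z) / 2 * norm (deriv L x) \<le> (1 - norm x) * norm (deriv L x)"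
        by (intro mult_right_mono in_disk that) auto
      also have "\<dots> \<le> \<beta>" by (intro \<beta> in_disk that)
      finally show ?thesis using z by (simp add: field_simps)
    qed
    have Lx: "norm (L x - L z) \<le> e / 3" if x: "x \<in> cball z \<rho>" for x
    proof -
      have "norm (L x - L z) \<le> 2 * \<beta> / (1 - norm z) * norm (x - z)"
      proof (rule field_differentiable_bound[OF convex_cball, of z \<rho> _ "deriv L"])
        fix y assume y: "y \<in> cball z \<rho>"
        show "(L has_field_derivative deriv L y) (at y within cball z \<rho>)"
          by (rule has_field_derivative_at_within[OF holomorphic_derivI[OF L(1) open_ball in_disk(2)[OF y]]])
      qed (use x \<rho>0 L_le in auto)
      also have "\<dots> \<le> 2 * \<beta> / (1 - norm z) * (\<eta> * (1 - norm z))"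
        using x \<beta> z by (intro mult_left_mono) (auto simp: \<rho>_def dist_norm norm_minus_commute)
      also have "\<dots> = 2 * \<beta> * \<eta>" using z by simp
      also have "\<dots> \<le> e / 3" using \<eta>\<beta> by simp
      finally show ?thesis .
    qed
    have dh: "norm (deriv h x - deriv h z) \<le> e * l" if x: "x \<in> cball z \<rho>" for x
    proof -
      have "deriv h x = deriv h z * exp (L x - L z)"
        using L(2)[OF in_disk(2)[OF x]] L(2)[OF z] deriv_h_nonzero[OF z] by (simp add: exp_diff)
      then have "deriv h x - deriv h z = deriv h z * (exp (L x - L z) - 1)"
        by (simp add: algebra_simps)
      moreover have "norm (exp (L x - L z) - 1) \<le> e"
        using norm_exp_minus_1_le[of "L x - L z"] Lx[OF x] e by linarith
      ultimately show ?thesis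
        by (simp add: norm_mult l_def mult.commute[of e] mult_left_mono)
    qed
    have dh_le: "norm (deriv h x) \<le> (1 + e) * l" if "x \<in> cball z \<rho>" for x
      using dh[OF that] norm_triangle_sub[of "deriv h x" "deriv h z"] by (simp add: l_def algebra_simps)
    have x\<zeta>: "\<zeta> \<in> cball z \<rho>" using \<zeta> by (simp add: \<rho>_def dist_norm norm_minus_commute)
    define t where "t = norm (\<zeta> - z)"
    have "norm ((h \<zeta> - deriv h z * \<zeta>) - (h z - deriv h z * z)) \<le> e * l * norm (\<zeta> - z)"
    proof (rule field_differentiable_bound[OF convex_cball, of z \<rho> _ "\<lambda>x. deriv h x - deriv h z"])
      fix y assume y: "y \<in> cball z \<rho>"
      have "(h has_field_derivative deriv h y) (at y)"
        by (rule holomorphic_derivI[OF holo_h open_ball in_disk(2)[OF y]])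
      then have "(h has_field_derivative deriv h y) (at y within cball z \<rho>)"
        by (rule has_field_derivative_at_within)
      then show "((\<lambda>x. h x - deriv h z * x) has_field_derivative deriv h y - deriv h z) (at y within cball z \<rho>)"
        by (auto intro!: derivative_eq_intros)
    qed (use dh x\<zeta> \<rho>0 in auto)
    then have H: "norm (h \<zeta> - h z - deriv h z * (\<zeta> - z)) \<le> e * (l * t)"
      by (simp add: t_def algebra_simps)
    have "norm (g \<zeta> - g z) \<le> k * ((1 + e) * l) * norm (\<zeta> - z)"
    proof (rule field_differentiable_bound[OF convex_cball, of z \<rho> _ "deriv g"])
      fix y assume y: "y \<in> cball z \<rho>"
      show "(g has_field_derivative deriv g y) (at y within cball z \<rho>)"
        by (rule has_field_derivative_at_within[OF holomorphic_derivI[OF holo_g open_ball in_disk(2)[OF y]]])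
      show "norm (deriv g y) \<le> k * ((1 + e) * l)"
        using dilatation[OF in_disk(2)[OF y]] mult_left_mono[OF dh_le[OF y] k_nonneg] by linarith
    qed (use x\<zeta> \<rho>0 in auto)
    then have G: "norm (g \<zeta> - g z) \<le> (k + k * e) * (l * t)"
      by (simp add: t_def algebra_simps)
    have lt: "0 \<le> l * t" by (simp add: l_def t_def)
    have ke: "k * e \<le> e" "k + k * e \<le> 5/4"
    proof -
      show "k * e \<le> e" using mult_right_mono[of k 1 e] e k_less_1 by simp
      then show "k + k * e \<le> 5/4" using e k_less_1 by linarith
    qed
    have mid: "norm (deriv h z * (\<zeta> - z)) = l * t" by (simp add: norm_mult l_def t_def)
    have h_up: "norm (h \<zeta> - h z) \<le> l * t + e * (l * t)"
      using H mid norm_triangle_sub[of "h \<zeta> - h z" "deriv h z * (\<zeta> - z)"] by linarith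
    have h_lo: "l * t - e * (l * t) \<le> norm (h \<zeta> - h z)"
      using H mid norm_triangle_ineq3[of "h \<zeta> - h z" "deriv h z * (\<zeta> - z)"] by linarith
    have f_diff: "f \<zeta> - f z = (h \<zeta> - h z) + cnj (g \<zeta> - g z)"
      using f_eq[OF z] f_eq[OF in_disk(2)[OF x\<zeta>]] by simp
    have up: "norm (f \<zeta> - f z) \<le> norm (h \<zeta> - h z) + norm (g \<zeta> - g z)"
      unfolding f_diff by (metis complex_mod_cnj norm_triangle_ineq)
    have lo: "norm (h \<zeta> - h z) - norm (g \<zeta> - g z) \<le> norm (f \<zeta> - f z)"
      unfolding f_diff by (metis complex_mod_cnj norm_diff_ineq)
    have "norm (f \<zeta> - f z) \<le> (1 + e + (k + k * e)) * (l * t)"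
      using up h_up G by (simp add: algebra_simps)
    also have "\<dots> \<le> 4 * (l * t)"
      by (rule mult_right_mono[OF _ lt]) (use ke e in linarith)
    finally have 1: "norm (f \<zeta> - f z) \<le> 4 * l * t" by simp
    have "(1 - k) / 2 * (l * t) \<le> (1 - e - (k + k * e)) * (l * t)"
    proof (rule mult_right_mono[OF _ lt])
      have "1 - k = 4 * e" by (simp add: e_def)
      then have "(1 - k) / 2 = 2 * e" "1 - e - (k + k * e) = 3 * e - k * e" by simp_all
      then show "(1 - k) / 2 \<le> 1 - e - (k + k * e)" using ke(1) by simp
    qed
    also have "\<dots> \<le> norm (f \<zeta> - f z)" using lo h_lo G by (simp add: algebra_simps)
    finally have 2: "(1 - k) / 2 * l * t \<le> norm (f \<zeta> - f z)" by simp
    show ?thesis using 1 2 by (simp add: l_def t_def)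
  qed
  show thesis by (rule that[OF \<eta>(1,2)]) (use est in auto)
qed

end

section \<open>The distance to the boundary from above\<close>

lemma Moebius_numerator_le:
  fixes z \<zeta> :: complex
  assumes "norm z \<le> 1" "norm \<zeta> \<le> 1"
  shows "norm (\<zeta> - z) \<le> norm (1 - cnj z * \<zeta>)"
proof (rule power2_le_imp_le)
  have "(norm (1 - cnj z * \<zeta>))\<^sup>2 - (norm (\<zeta> - z))\<^sup>2 = (1 - (norm z)\<^sup>2) * (1 - (norm \<zeta>)\<^sup>2)"
    unfolding cmod_power2 by (simp add: power2_eq_square algebra_simps)
  moreover have "0 \<le> (1 - (norm z)\<^sup>2) * (1 - (norm \<zeta>)\<^sup>2)"
    using assms by (simp add: power_le_one_iff)
  ultimately show "(norm (\<zeta> - z))\<^sup>2 \<le> (norm (1 - cnj z * \<zeta>))\<^sup>2" by linarith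
qed simp

context harmonic_qc_disk begin

lemma dilatation_strict: "norm (deriv g z) < norm (deriv h z)" if "z \<in> unit_disk"
proof -
  have "k * norm (deriv h z) < 1 * norm (deriv h z)"
    using deriv_h_nonzero[OF that] k_less_1 by (intro mult_strict_right_mono) auto
  then show ?thesis using dilatation[OF that] by linarith
qed

lemma open_image: "open (f ` unit_disk)"
  by (intro invariance_of_domain continuous_f inj) auto

text \<open>
  Let \<open>e = f \<zeta> - f z\<close> and let \<open>p t\<close> be the preimage of \<open>f z + t e\<close>. Then \<open>u = h' (p t) * p' t\<close> differs
  from \<open>e\<close> by the conjugate of \<open>g' (p t) * p' t\<close>, which is no larger than \<open>u\<close>. From \<open>|e - u| \<le> |u|\<close> it follows that
  \<open>Re (cnj e * u) \<ge> |e|\<^sup>2 / 2\<close>, so \<open>Re (cnj e * h (p t))\<close> grows at least at this rate.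
\<close>

lemma analytic_part_expands:
  assumes z: "z \<in> unit_disk" and \<zeta>: "\<zeta> \<in> unit_disk"
    and seg: "closed_segment (f z) (f \<zeta>) \<subseteq> f ` unit_disk"
  shows "norm (f \<zeta> - f z) \<le> 2 * norm (h \<zeta> - h z)"
proof (cases "f \<zeta> = f z")
  case False
  obtain G where G: "homeomorphism unit_disk (f ` unit_disk) f G"
    by (rule invariance_of_domain_homeomorphism[OF open_ball continuous_f _ inj]) auto
  define e where "e = f \<zeta> - f z"
  define line where "line t = f z + of_real t * e" for t :: real
  define q where "q t = Re (cnj e * h (G (line t)))" for t
  have e: "e \<noteq> 0" using False by (simp add: e_def)
  have line_in: "line t \<in> f ` unit_disk" if "0 \<le> t" "t \<le> 1" for t
  proof -
    have "line t \<in> closed_segment (f z) (f \<zeta>)"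
      unfolding in_segment using that
      by (intro exI[of _ t]) (simp add: line_def e_def scaleR_conv_of_real algebra_simps)
    then show ?thesis using seg by blast
  qed
  have "\<exists>D. (q has_real_derivative D) (at t) \<and> (norm e)\<^sup>2 / 2 \<le> D" if t: "0 \<le> t" "t \<le> 1" for t
  proof -
    define p where "p = G (line t)"
    define \<alpha> where "\<alpha> = deriv h p"
    define \<beta> where "\<beta> = deriv g p"
    have p: "p \<in> unit_disk" and fp: "f p = line t"
      using G line_in[OF t] by (auto simp: p_def homeomorphism_def)
    define J where "J = (norm \<alpha>)\<^sup>2 - (norm \<beta>)\<^sup>2"
    have "norm \<beta> < norm \<alpha>" using dilatation_strict[OF p] by (simp add: \<alpha>_def \<beta>_def)
    then have J: "0 < J" by (simp add: J_def power_strict_mono)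
    then have J0: "complex_of_real J \<noteq> 0" by simp
    have J_eq: "complex_of_real J = \<alpha> * cnj \<alpha> - \<beta> * cnj \<beta>"
      by (simp add: J_def complex_norm_square[symmetric])
    \<comment> \<open>The inverse of the differential \<open>v \<mapsto> \<alpha> v + cnj (\<beta> v)\<close> of \<open>f\<close>, by Cramer's rule.\<close>
    define T where "T w = (cnj \<alpha> * w - cnj \<beta> * cnj w) / of_real J" for w
    have T_right: "\<alpha> * T w + cnj (\<beta> * T w) = w" for w
    proof -
      have "(\<alpha> * T w + cnj (\<beta> * T w)) * of_real J = w * of_real J"
        using J0 by (simp add: T_def add_divide_distrib[symmetric]) (simp add: J_eq algebra_simps)
      then show ?thesis using J0 by simp
    qed
    have T_left: "T (\<alpha> * v + cnj (\<beta> * v)) = v" for v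
      unfolding T_def using J0 by (simp add: nonzero_divide_eq_eq) (simp add: J_eq algebra_simps)
    have dG: "(G has_derivative T) (at (line t))"
    proof (rule has_derivative_inverse_basic[where f = f and T = "f ` unit_disk"])
      show "(f has_derivative (\<lambda>v. \<alpha> * v + cnj (\<beta> * v))) (at (G (line t)))"
        using has_derivative_harmonic[OF holo_h holo_g f_eq p] by (simp add: \<alpha>_def \<beta>_def p_def)
      have "T = (\<lambda>w. (cnj \<alpha> / of_real J) * w - (cnj \<beta> / of_real J) * cnj w)"
        by (simp add: T_def fun_eq_iff diff_divide_distrib)
      then show "bounded_linear T"
        by (simp only:) (intro bounded_linear_sub bounded_linear_mult_right
            bounded_linear_compose[OF bounded_linear_mult_right bounded_linear_cnj])
      show "T \<circ> (\<lambda>v. \<alpha> * v + cnj (\<beta> * v)) = id" using T_left by (simp add: fun_eq_iff)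
      show "continuous (at (line t)) G"
        using G open_image line_in[OF t] by (auto simp: homeomorphism_def continuous_on_eq_continuous_at)
      show "f (G y) = y" if "y \<in> f ` unit_disk" for y
        using G that by (auto simp: homeomorphism_def)
    qed (use open_image line_in[OF t] in auto)
    have dline: "(line has_vector_derivative e) (at t)"
      unfolding line_def by (auto intro!: derivative_eq_intros)
    have "((G \<circ> line) has_vector_derivative T e) (at t)"
      by (rule vector_derivative_diff_chain_within[OF dline has_derivative_at_withinI[OF dG]])
    then have "((h \<circ> (G \<circ> line)) has_vector_derivative T e * \<alpha>) (at t)"
      by (rule field_vector_diff_chain_at)
        (use holomorphic_derivI[OF holo_h open_ball p] in \<open>simp add: p_def \<alpha>_def\<close>)
    then have "((\<lambda>t. Re (cnj e * h (G (line t)))) has_vector_derivative Re (cnj e * (T e * \<alpha>))) (at t)"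
      unfolding o_def
      by (rule bounded_linear.has_vector_derivative[OF bounded_linear_compose[OF bounded_linear_Re bounded_linear_mult_right]])
    then have "(q has_real_derivative Re (cnj e * (T e * \<alpha>))) (at t)"
      by (simp add: has_real_derivative_iff_has_vector_derivative q_def[abs_def])
    moreover have "(norm e)\<^sup>2 / 2 \<le> Re (cnj e * (T e * \<alpha>))"
    proof -
      define u where "u = T e * \<alpha>"
      have "e - u = cnj (\<beta> * T e)"
        using T_right[of e] by (simp add: u_def algebra_simps)
      then have "norm (e - u) = norm \<beta> * norm (T e)"
        by (simp add: norm_mult)
      also have "\<dots> \<le> norm u"
        using \<open>norm \<beta> < norm \<alpha>\<close> by (simp add: u_def norm_mult mult.commute[of "norm (T e)"] mult_right_mono)
      finally have "(norm (e - u))\<^sup>2 \<le> (norm u)\<^sup>2" by (intro power_mono) auto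
      then show ?thesis
        unfolding u_def[symmetric] cmod_power2 by (simp add: power2_eq_square algebra_simps)
    qed
    ultimately show ?thesis by blast
  qed
  then obtain q' where q': "\<And>t. 0 \<le> t \<Longrightarrow> t \<le> 1 \<Longrightarrow> (q has_real_derivative q' t) (at t)"
    "\<And>t. 0 \<le> t \<Longrightarrow> t \<le> 1 \<Longrightarrow> (norm e)\<^sup>2 / 2 \<le> q' t"
    by metis
  obtain t where "0 < t" "t < 1" "q 1 - q 0 = (1 - 0) * q' t"
    using MVT2[of 0 1 q q'] q'(1) by auto
  then have "(norm e)\<^sup>2 / 2 \<le> q 1 - q 0" using q'(2)[of t] by simp
  also have "q 1 - q 0 = Re (cnj e * (h \<zeta> - h z))"
    using G z \<zeta> by (simp add: q_def line_def e_def homeomorphism_def algebra_simps)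
  also have "\<dots> \<le> norm e * norm (h \<zeta> - h z)"
    by (metis complex_Re_le_cmod norm_mult complex_mod_cnj)
  finally show ?thesis
    using e by (simp add: e_def power2_eq_square)
qed simp

text \<open>
  On the preimage \<open>U\<close> of a disk of radius \<open>s < R\<close> about \<open>f z\<close>, the function \<open>\<Theta>\<close> is the quotient of the
  disk automorphism \<open>(\<zeta> - z) / (1 - cnj z \<zeta>)\<close> by \<open>h \<zeta> - h z\<close>, with the singularity at \<open>z\<close> removed. On the
  boundary of \<open>U\<close> the numerator is at most \<open>1\<close> and the denominator at least \<open>s / 2\<close>; the value at \<open>z\<close> is
  \<open>1 / ((1 - |z|\<^sup>2) h' z)\<close>. The maximum principle compares the two.
\<close>

lemma image_ball_radius_le:
  assumes z: "z \<in> unit_disk" and R: "ball (f z) R \<subseteq> f ` unit_disk"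
  shows "R \<le> 2 * (1 - (norm z)\<^sup>2) * norm (deriv h z)"
proof (rule dense_le)
  fix s assume "s < R"
  have nz: "0 < 1 - (norm z)\<^sup>2" using z by (simp add: power_less_one_iff)
  show "s \<le> 2 * (1 - (norm z)\<^sup>2) * norm (deriv h z)"
  proof (cases "0 < s")
    case False
    then show ?thesis using nz
      by (meson dual_order.trans mult_nonneg_nonneg norm_ge_zero not_le less_imp_le zero_le_numeral)
  next
    case True
    obtain G where G: "homeomorphism unit_disk (f ` unit_disk) f G"
      by (rule invariance_of_domain_homeomorphism[OF open_ball continuous_f _ inj]) auto
    have sub: "cball (f z) s \<subseteq> f ` unit_disk" using R \<open>s < R\<close> by force
    define W where "W = G ` cball (f z) s"
    define U where "U = {x \<in> unit_disk. f x \<in> ball (f z) s}"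
    have W_eq: "W = {x \<in> unit_disk. f x \<in> cball (f z) s}"
    proof
      show "W \<subseteq> {x \<in> unit_disk. f x \<in> cball (f z) s}"
        using G sub unfolding W_def homeomorphism_def by (auto simp: subset_iff image_iff)
      show "{x \<in> unit_disk. f x \<in> cball (f z) s} \<subseteq> W"
        using G unfolding W_def homeomorphism_def by (force simp: image_iff)
    qed
    have "continuous_on (f ` unit_disk) G" using G by (simp add: homeomorphism_def)
    then have "compact W"
      unfolding W_def by (rule compact_continuous_image[OF continuous_on_subset[OF _ sub] compact_cball])
    have U_open: "open U"
      using continuous_open_preimage[OF continuous_f open_ball open_ball, of "f z" s]
      by (simp add: U_def vimage_def Int_def conj_commute)
    have UW: "U \<subseteq> W" unfolding U_def W_eq by auto
    then have clU: "closure U \<subseteq> W" using \<open>compact W\<close> by (simp add: closure_minimal compact_imp_closed)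
    have frU: "norm (f x - f z) = s" if "x \<in> frontier U" for x
    proof -
      have "x \<in> W" "x \<notin> U" using that clU U_open by (auto simp: frontier_def interior_open)
      then show ?thesis by (auto simp: W_eq U_def dist_norm norm_minus_commute)
    qed
    define Q where "Q x = (if x = z then deriv h z else (h x - h z) / (x - z))" for x
    have holo_Q: "Q holomorphic_on unit_disk"
      unfolding Q_def by (intro pole_lemma_open holo_h) auto
    have h_ge: "norm (f x - f z) \<le> 2 * norm (h x - h z)" if "x \<in> W" for x
    proof (rule analytic_part_expands[OF z])
      have "f z \<in> cball (f z) s" "f x \<in> cball (f z) s" using that True by (auto simp: W_eq)
      then have "closed_segment (f z) (f x) \<subseteq> cball (f z) s"
        by (intro closed_segment_subset) auto
      then show "closed_segment (f z) (f x) \<subseteq> f ` unit_disk" using sub by blast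
    qed (use that in \<open>auto simp: W_eq\<close>)
    have Q0: "Q x \<noteq> 0" if "x \<in> W" for x
    proof (cases "x = z")
      case False
      then have "f x \<noteq> f z" using inj that z by (auto simp: W_eq inj_on_def)
      then show ?thesis using h_ge[OF that] False by (auto simp: Q_def)
    qed (use deriv_h_nonzero[OF z] in \<open>simp add: Q_def\<close>)
    have M0: "1 - cnj z * x \<noteq> 0" if "x \<in> unit_disk" for x
    proof -
      have "norm (cnj z * x) < 1"
        using z that mult_strict_mono[of "norm z" 1 "norm x" 1] by (simp add: norm_mult)
      then show ?thesis by auto
    qed
    define \<Theta> where "\<Theta> x = 1 / ((1 - cnj z * x) * Q x)" for x
    have "continuous_on W \<Theta>"
      unfolding \<Theta>_def using Q0 M0
      by (intro continuous_intros continuous_on_subset[OF holomorphic_on_imp_continuous_on[OF holo_Q]])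
        (auto simp: W_eq)
    have "norm (\<Theta> z) \<le> 2 / s"
    proof (rule maximum_modulus_frontier[of \<Theta> U _ z])
      show "\<Theta> holomorphic_on interior U"
        unfolding \<Theta>_def interior_open[OF U_open]
        using Q0 M0 UW
        by (intro holomorphic_intros holomorphic_on_subset[OF holo_Q]) (auto simp: U_def)
      show "continuous_on (closure U) \<Theta>" using \<open>continuous_on W \<Theta>\<close> clU continuous_on_subset by blast
      show "bounded U" using UW \<open>compact W\<close> bounded_subset compact_imp_bounded by blast
      show "z \<in> U" using z True by (simp add: U_def)
      fix x assume x: "x \<in> frontier U"
      have "x \<in> W" using x clU by (auto simp: frontier_def)
      have "norm (f x - f z) = s" using frU x .
      then have "x \<noteq> z" using True by auto
      have hx: "s / 2 \<le> norm (h x - h z)" using h_ge[OF \<open>x \<in> W\<close>] \<open>norm (f x - f z) = s\<close> by simp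
      have "norm (\<Theta> x) = norm (x - z) / (norm (1 - cnj z * x) * norm (h x - h z))"
        using \<open>x \<noteq> z\<close> by (simp add: \<Theta>_def Q_def norm_divide norm_mult)
      also have "\<dots> \<le> norm (1 - cnj z * x) / (norm (1 - cnj z * x) * norm (h x - h z))"
        using z \<open>x \<in> W\<close> by (intro divide_right_mono Moebius_numerator_le) (auto simp: W_eq)
      also have "\<dots> = 1 / norm (h x - h z)"
        using M0 \<open>x \<in> W\<close> by (simp add: W_eq)
      also have "\<dots> \<le> 1 / (s / 2)"
        using hx True by (intro frac_le) auto
      finally show "norm (\<Theta> x) \<le> 2 / s" by simp
    qed
    moreover have "norm (\<Theta> z) = 1 / ((1 - (norm z)\<^sup>2) * norm (deriv h z))"
    proof -
      have "1 - cnj z * z = of_real (1 - (norm z)\<^sup>2)"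
        unfolding of_real_diff complex_norm_square by (simp add: mult.commute)
      then have "norm (1 - cnj z * z) = 1 - (norm z)\<^sup>2" using nz by (metis abs_of_pos norm_of_real)
      then show ?thesis by (simp add: \<Theta>_def Q_def norm_divide norm_mult)
    qed
    ultimately show ?thesis
      using True nz deriv_h_nonzero[OF z] by (simp add: field_simps)
  qed
qed

end

section \<open>Hoelder estimates from distortion and the John condition\<close>

text \<open>
  The tails \<open>S n\<close> of the series satisfy \<open>S (n + 1) = S n - a n \<le> (1 - 1/M) S n\<close>.
\<close>

lemma geometric_decay:
  fixes a :: "nat \<Rightarrow> real"
  assumes pos: "\<And>n. 0 < a n" and tail: "\<And>m n. (\<Sum>i<n. a (m + i)) \<le> M * a m" and M: "1 < M"
  shows "a n \<le> M * (1 - 1 / M) ^ n * a 0"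
proof -
  have summable_tail: "summable (\<lambda>i. a (m + i))" for m
    using pos tail by (intro summableI_nonneg_bounded[of _ "M * a m"]) (auto intro: less_imp_le)
  define S where "S m = (\<Sum>i. a (m + i))" for m
  have S_le: "S m \<le> M * a m" for m
    unfolding S_def by (intro suminf_le_const summable_tail tail)
  have S_Suc: "S (Suc m) = S m - a m" for m
    using suminf_split_head[OF summable_tail[of m]] by (simp add: S_def)
  have S_ge: "a m \<le> S m" for m
    using S_Suc[of m] suminf_nonneg[OF summable_tail[of "Suc m"]] pos
    by (simp add: S_def less_imp_le)
  have "S n \<le> (1 - 1 / M) ^ n * S 0"
  proof (induction n)
    case (Suc n)
    have "S (Suc n) \<le> (1 - 1 / M) * S n"
      using S_le[of n] M by (simp add: S_Suc field_simps)
    also have "\<dots> \<le> (1 - 1 / M) * ((1 - 1 / M) ^ n * S 0)"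
      using Suc M by (intro mult_left_mono) auto
    finally show ?case by simp
  qed simp
  also have "\<dots> \<le> (1 - 1 / M) ^ n * (M * a 0)"
    using S_le M by (intro mult_left_mono) auto
  finally show ?thesis using S_ge[of n] by (simp add: mult_ac)
qed

lemma le_powr_of_le_1:
  fixes x \<delta> :: real
  assumes "0 \<le> x" "x \<le> 1" "0 < \<delta>" "\<delta> \<le> 1"
  shows "x \<le> x powr \<delta>"
  using powr_mono'[of \<delta> 1 x] assms by simp

lemma powr_le_of_ge_1:
  fixes x \<delta> :: real
  assumes "1 \<le> x" "\<delta> \<le> 1"
  shows "x powr \<delta> \<le> x"
  using powr_mono[of \<delta> 1 x] assms by simp

text \<open>
  A point of \<open>B(z)\<close> lies on a radius whose point of modulus \<open>|z|\<close> is within \<open>\<pi> (1 - |z|)\<close> of \<open>z\<close>; for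
  \<open>\<zeta> = 0\<close>, where the direction \<open>e\<close> is arbitrary, this holds because then \<open>z = 0\<close>.
\<close>

lemma Bset_polar:
  assumes z: "z \<in> unit_disk" and \<zeta>: "\<zeta> \<in> Bset z"
  obtains e where "norm e = 1" "\<zeta> = of_real (norm \<zeta>) * e" "norm z \<le> norm \<zeta>" "norm \<zeta> < 1"
    "norm (of_real (norm z) * e - z) \<le> pi * (1 - norm z)"
proof (cases "z = 0")
  case True
  obtain e :: complex where "norm e = 1" "\<zeta> = of_real (norm \<zeta>) * e"
  proof (cases "\<zeta> = 0")
    case False
    then have "norm (sgn \<zeta>) = 1" "\<zeta> = of_real (norm \<zeta>) * sgn \<zeta>"
      by (simp add: norm_sgn, simp add: sgn_eq)
    then show thesis by (rule that)
  qed (use that[of 1] in auto)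
  then show thesis using that[of e] \<zeta> True by (auto simp: Bset_def)
next
  case False
  then obtain \<theta> k where *: "norm z \<le> norm \<zeta>" "norm \<zeta> < 1"
      "Arg z - Arg \<zeta> = \<theta> + 2 * pi * of_int (k::int)" "\<bar>\<theta>\<bar> \<le> pi * (1 - norm z)"
    using \<zeta> by (auto simp: Bset_def)
  define e where "e = cis (Arg \<zeta>)"
  have \<zeta>_eq: "\<zeta> = of_real (norm \<zeta>) * e"
    by (metis e_def rcis_cmod_Arg rcis_def)
  have "Arg z = Arg \<zeta> + \<theta> + 2 * pi * of_int k" using *(3) by simp
  then have "cis (Arg z) = e * cis \<theta> * cis (2 * pi * of_int k)"
    by (simp only: e_def cis_mult)
  then have "cis (Arg z) = e * cis \<theta>" by simp
  then have z_eq: "z = of_real (norm z) * (e * cis \<theta>)"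
    by (metis rcis_cmod_Arg rcis_def)
  have "norm (of_real (norm z) * e - z) = norm z * norm (1 - cis \<theta>)"
  proof -
    have "of_real (norm z) * e - z = of_real (norm z) * e * (1 - cis \<theta>)"
      by (subst (2) z_eq) (simp add: algebra_simps)
    then show ?thesis by (simp add: norm_mult e_def)
  qed
  also have "\<dots> \<le> 1 * norm (1 - cis \<theta>)"
    using z by (intro mult_right_mono) auto
  also have "norm (1 - cis \<theta>) = 2 * \<bar>sin (\<theta> / 2)\<bar>"
    using dist_exp_i_1[of \<theta>] by (simp add: cis_conv_exp norm_minus_commute)
  also have "1 * \<dots> \<le> \<bar>\<theta>\<bar>" using abs_sin_x_le_abs_x[of "\<theta> / 2"] by simp
  finally have "norm (of_real (norm z) * e - z) \<le> pi * (1 - norm z)" using *(4) by linarith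
  then show thesis using that[of e] * \<zeta>_eq by (simp add: e_def)
qed

text \<open>
  What the Hoelder estimate uses about \<open>f\<close>, with \<open>d z\<close> in the role of the distance of \<open>f z\<close> from
  the boundary: on disks of radius \<open>\<eta> (1 - |z|)\<close> the map \<open>f\<close> is Lipschitz at the scale of \<open>d z\<close> (upper), it moves
  by an amount comparable to \<open>d z\<close> from the centre to the boundary of such a disk (lower), and images of outer
  radial segments have length at most \<open>c * d\<close> at their inner end point (John).
\<close>

locale Whitney_John =
  fixes f :: "complex \<Rightarrow> complex" and d :: "complex \<Rightarrow> real" and \<eta> C1 c2 c :: real
  assumes d_pos: "\<And>z. z \<in> unit_disk \<Longrightarrow> 0 < d z"
    and d_lipschitz: "\<And>a b. a \<in> unit_disk \<Longrightarrow> b \<in> unit_disk \<Longrightarrow> d b \<le> d a + norm (f b - f a)"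
    and \<eta>: "0 < \<eta>" "\<eta> \<le> 1/2"
    and upper: "\<And>z \<zeta>. z \<in> unit_disk \<Longrightarrow> norm (\<zeta> - z) \<le> \<eta> * (1 - norm z) \<Longrightarrow>
        norm (f \<zeta> - f z) \<le> C1 * d z * (norm (\<zeta> - z) / (1 - norm z))"
    and lower: "\<And>z \<zeta>. z \<in> unit_disk \<Longrightarrow> norm (\<zeta> - z) = \<eta> * (1 - norm z) \<Longrightarrow>
        c2 * d z \<le> norm (f \<zeta> - f z)"
    and John: "\<And>e R n. norm e = 1 \<Longrightarrow> mono R \<Longrightarrow> range R \<subseteq> {0..<1} \<Longrightarrow>
        (\<Sum>i<n. norm (f (of_real (R (Suc i)) * e) - f (of_real (R i) * e))) \<le> c * d (of_real (R 0) * e)"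
    and C1_nonneg: "0 \<le> C1" and c2_pos: "0 < c2" and c_nonneg: "0 \<le> c"
begin

lemma radial_oscillation:
  assumes "norm e = 1" "0 \<le> r" "r \<le> \<rho>" "\<rho> < 1"
  shows "norm (f (of_real \<rho> * e) - f (of_real r * e)) \<le> c * d (of_real r * e)"
proof -
  define R where "R i = (if i = 0 then r else \<rho>)" for i :: nat
  have "mono R" using assms by (auto simp: R_def mono_def)
  moreover have "range R \<subseteq> {0..<1}" using assms by (auto simp: R_def)
  ultimately show ?thesis using John[of e R 1] assms by (simp add: R_def)
qed

text \<open>
  The points \<open>R m\<close> satisfy \<open>1 - R m = (1 - r) (1 - \<eta>)^m\<close>, so that consecutive points are at distance
  \<open>\<eta> (1 - R m)\<close>, the one in assumption \<open>lower\<close>. Together with the John condition this bounds \<open>\<Sum>i. d (R (m + i))\<close> by a multiple of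
  \<open>d (R m)\<close>, for every \<open>m\<close>; hence \<open>d (R m)\<close> decays geometrically. The exponent \<open>\<delta>\<close> is chosen with
  \<open>\<theta> \<le> q powr \<delta>\<close>, where \<open>\<theta>\<close> is the rate of decay and \<open>q = 1 - \<eta>\<close>.
\<close>

lemma radial_decay:
  obtains M \<delta> where "0 < M" "0 < \<delta>" "\<delta> < 1"
    "\<And>e r \<rho>. norm e = 1 \<Longrightarrow> 0 \<le> r \<Longrightarrow> r \<le> \<rho> \<Longrightarrow> \<rho> < 1 \<Longrightarrow>
       d (of_real \<rho> * e) \<le> M * ((1 - \<rho>) / (1 - r)) powr \<delta> * d (of_real r * e)"
proof -
  define q where "q = 1 - \<eta>"
  define M where "M = c / c2 + 2"
  define \<theta> where "\<theta> = 1 - 1 / M"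
  define \<delta> where "\<delta> = min (1/2) (ln \<theta> / ln q)"
  have q: "1/2 \<le> q" "q < 1" using \<eta> by (auto simp: q_def)
  have "0 \<le> c / c2" using c_nonneg c2_pos by simp
  then have M: "1 < M" unfolding M_def by linarith
  have \<theta>: "0 < \<theta>" "\<theta> < 1" using M by (auto simp: \<theta>_def)
  have \<delta>: "0 < \<delta>" "\<delta> < 1" using \<theta> q by (auto simp: \<delta>_def divide_neg_neg)
  have "ln \<theta> \<le> \<delta> * ln q"
  proof -
    have "\<delta> \<le> ln \<theta> / ln q" by (simp add: \<delta>_def)
    moreover have "ln q < 0" using q by simp
    ultimately show ?thesis by (simp add: neg_le_divide_eq)
  qed
  then have "exp (ln \<theta>) \<le> exp (\<delta> * ln q)" by simp
  then have \<theta>q: "\<theta> \<le> q powr \<delta>" using \<theta> q by (simp add: powr_def)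
  have est: "d (of_real \<rho> * e) \<le> 2 * (1 + c) * M * ((1 - \<rho>) / (1 - r)) powr \<delta> * d (of_real r * e)"
    if e: "norm e = 1" and r: "0 \<le> r" "r \<le> \<rho>" "\<rho> < 1" for e r \<rho>
  proof -
    define R where "R m = 1 - (1 - r) * q ^ m" for m :: nat
    have R0: "R 0 = r" by (simp add: R_def)
    have R_range: "R m \<in> {0..<1}" for m
    proof -
      have "(1 - r) * q ^ m \<le> 1 * 1" using r q by (intro mult_mono power_le_one) auto
      moreover have "0 < (1 - r) * q ^ m" using r q by simp
      ultimately show ?thesis by (simp add: R_def)
    qed
    have "mono R"
      unfolding mono_def R_def using r q by (auto intro!: mult_left_mono power_decreasing)
    have step: "R (Suc m) - R m = \<eta> * (1 - R m)" for m
      by (simp add: R_def q_def algebra_simps)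
    have in_disk: "of_real (R m) * e \<in> unit_disk" for m
      using R_range[of m] e by (simp add: norm_mult)
    have low: "c2 * d (of_real (R m) * e) \<le> norm (f (of_real (R (Suc m)) * e) - f (of_real (R m) * e))" for m
    proof (rule lower[OF in_disk])
      have "norm (of_real (R (Suc m)) * e - of_real (R m) * e) = \<bar>R (Suc m) - R m\<bar>"
        using e by (metis left_diff_distrib norm_mult norm_of_real of_real_diff mult.right_neutral)
      also have "\<dots> = \<eta> * (1 - norm (of_real (R m) * e))"
        using R_range[of m] e \<eta> by (simp add: step norm_mult)
      finally show "norm (of_real (R (Suc m)) * e - of_real (R m) * e) = \<eta> * (1 - norm (of_real (R m) * e))" .
    qed
    have decay: "d (of_real (R n) * e) \<le> M * \<theta> ^ n * d (of_real (R 0) * e)" for n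
      unfolding \<theta>_def
    proof (rule geometric_decay[OF d_pos[OF in_disk] _ M])
      fix m n :: nat
      have "c2 * (\<Sum>i<n. d (of_real (R (m + i)) * e))
          \<le> (\<Sum>i<n. norm (f (of_real (R (m + Suc i)) * e) - f (of_real (R (m + i)) * e)))"
        unfolding sum_distrib_left using low by (intro sum_mono) simp
      also have "\<dots> \<le> c * d (of_real (R (m + 0)) * e)"
        using \<open>mono R\<close> R_range by (intro John e) (auto simp: mono_def)
      finally have "(\<Sum>i<n. d (of_real (R (m + i)) * e)) \<le> c / c2 * d (of_real (R m) * e)"
        using c2_pos by (simp add: field_simps)
      also have "\<dots> \<le> M * d (of_real (R m) * e)"
        using d_pos[OF in_disk[of m]] by (intro mult_right_mono) (auto simp: M_def)
      finally show "(\<Sum>i<n. d (of_real (R (m + i)) * e)) \<le> M * d (of_real (R m) * e)" .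
    qed
    define x where "x = (1 - \<rho>) / (1 - r)"
    have x: "0 < x" "x \<le> 1" using r by (auto simp: x_def)
    \<comment> \<open>\<open>R n\<close> is the last division point that does not exceed \<open>\<rho>\<close>.\<close>
    obtain n where n: "q ^ Suc n < x" "x \<le> q ^ n"
    proof -
      have ex: "\<exists>n. q ^ n < x" using real_arch_pow_inv[OF x(1) q(2)] by blast
      define N where "N = (LEAST n. q ^ n < x)"
      have N: "q ^ N < x" unfolding N_def using ex by (rule LeastI_ex)
      then have "N \<noteq> 0" using x by (intro notI) simp
      then obtain n where "N = Suc n" using not0_implies_Suc by blast
      then have "\<not> q ^ n < x" unfolding N_def by (intro not_less_Least) simp
      then show thesis using that[of n] N \<open>N = Suc n\<close> by simp
    qed
    have "1 - \<rho> = (1 - r) * x" using r by (simp add: x_def)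
    also have "\<dots> \<le> (1 - r) * q ^ n" using n r by (intro mult_left_mono) auto
    finally have "R n \<le> \<rho>" by (simp add: R_def)
    have q\<delta>: "1 \<le> 2 * q powr \<delta>"
    proof -
      have "1/2 \<le> q powr \<delta>" using le_powr_of_le_1[of q \<delta>] q \<delta> by linarith
      then show ?thesis by simp
    qed
    have "\<theta> ^ n \<le> (q powr \<delta>) ^ n" using \<theta> \<theta>q by (intro power_mono) auto
    also have "\<dots> \<le> (q powr \<delta>) ^ n * (2 * q powr \<delta>)"
      using q\<delta> mult_left_mono[of 1 "2 * q powr \<delta>" "(q powr \<delta>) ^ n"] by simp
    also have "\<dots> = 2 * (q ^ Suc n) powr \<delta>"
      using q by (simp add: powr_mult powr_power powr_realpow[symmetric] powr_powr mult.commute)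
    also have "\<dots> \<le> 2 * x powr \<delta>"
      using n q \<delta> by (intro mult_left_mono powr_mono2) auto
    finally have \<theta>x: "\<theta> ^ n \<le> 2 * x powr \<delta>" .
    have \<rho>: "of_real \<rho> * e \<in> unit_disk" using r e by (simp add: norm_mult)
    have "d (of_real \<rho> * e) \<le> d (of_real (R n) * e) + norm (f (of_real \<rho> * e) - f (of_real (R n) * e))"
      by (rule d_lipschitz[OF in_disk \<rho>])
    also have "\<dots> \<le> d (of_real (R n) * e) + c * d (of_real (R n) * e)"
      using radial_oscillation[OF e, of "R n" \<rho>] R_range[of n] \<open>R n \<le> \<rho>\<close> r by simp
    also have "\<dots> = (1 + c) * d (of_real (R n) * e)" by (simp add: algebra_simps)
    also have "\<dots> \<le> (1 + c) * (M * \<theta> ^ n * d (of_real (R 0) * e))"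
      using c_nonneg by (intro mult_left_mono decay) auto
    also have "\<dots> \<le> (1 + c) * (M * (2 * x powr \<delta>) * d (of_real (R 0) * e))"
      using c_nonneg M \<theta>x d_pos[OF in_disk[of 0]]
      by (intro mult_left_mono mult_right_mono) auto
    also have "\<dots> = 2 * (1 + c) * M * x powr \<delta> * d (of_real r * e)"
      by (simp add: R0 algebra_simps)
    finally show ?thesis by (simp add: x_def)
  qed
  show thesis
    by (rule that[of "2 * (1 + c) * M" \<delta>]) (use c_nonneg M \<delta> est in auto)
qed

text \<open>
  The segment from \<open>a\<close> to \<open>b\<close> stays in the disk of radius \<open>1 - \<tau>\<close> and is divided into \<open>n \<approx> A / \<eta>\<close> pieces of
  length at most \<open>\<eta> \<tau>\<close>. Along each piece \<open>f\<close> moves by at most \<open>C1 * d\<close> at its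
  first point, so \<open>d\<close> grows at most by the factor \<open>1 + C1\<close>.
\<close>

lemma Harnack:
  obtains B where "0 \<le> B"
    "\<And>\<tau> a b. 0 < \<tau> \<Longrightarrow> norm a \<le> 1 - \<tau> \<Longrightarrow> norm b \<le> 1 - \<tau> \<Longrightarrow> norm (a - b) \<le> A * \<tau> \<Longrightarrow>
       norm (f b - f a) \<le> B * d a"
proof -
  define n where "n = nat \<lceil>A / \<eta>\<rceil> + 1"
  have n: "0 < n" "A / \<eta> \<le> real n" by (auto simp: n_def) linarith
  then have n': "A / real n \<le> \<eta>" using \<eta> by (simp add: field_simps)
  have est: "norm (f b - f a) \<le> ((1 + C1) ^ n - 1) * d a"
    if \<tau>: "0 < \<tau>" and a: "norm a \<le> 1 - \<tau>" and b: "norm b \<le> 1 - \<tau>" and ab: "norm (a - b) \<le> A * \<tau>" for \<tau> a b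
  proof -
    define x where "x i = a + of_real (real i / real n) * (b - a)" for i
    have x_in: "norm (x i) \<le> 1 - \<tau>" if "i \<le> n" for i
    proof -
      have "x i \<in> closed_segment a b"
        unfolding in_segment using that n(1)
        by (intro exI[of _ "real i / real n"]) (simp add: x_def scaleR_conv_of_real algebra_simps diff_divide_distrib)
      moreover have "closed_segment a b \<subseteq> cball 0 (1 - \<tau>)"
        using a b by (intro closed_segment_subset) auto
      ultimately show ?thesis by auto
    qed
    have x_disk: "x i \<in> unit_disk" if "i \<le> n" for i using x_in[OF that] \<tau> by simp
    have "norm (f (x i) - f a) \<le> ((1 + C1) ^ i - 1) * d a" if "i \<le> n" for i
      using that
    proof (induction i)
      case 0
      then show ?case by (simp add: x_def)
    next
      case (Suc i)
      then have IH: "norm (f (x i) - f a) \<le> ((1 + C1) ^ i - 1) * d a" and i: "i \<le> n" by auto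
      have "d (x i) \<le> d a + norm (f (x i) - f a)"
        by (rule d_lipschitz[OF _ x_disk[OF i]]) (use a \<tau> in simp)
      also have "\<dots> \<le> (1 + C1) ^ i * d a" using IH by (simp add: algebra_simps)
      finally have dx: "d (x i) \<le> (1 + C1) ^ i * d a" .
      have "x (Suc i) - x i = (b - a) / of_nat n"
        using n(1) by (simp add: x_def field_simps)
      then have "norm (x (Suc i) - x i) = norm (a - b) / real n"
        by (simp add: norm_divide norm_minus_commute)
      also have "\<dots> \<le> A * \<tau> / real n" using ab by (intro divide_right_mono) auto
      also have "\<dots> \<le> \<eta> * \<tau>" using mult_right_mono[OF n', of \<tau>] \<tau> by simp
      also have "\<dots> \<le> \<eta> * (1 - norm (x i))" using x_in[OF i] \<eta> by (intro mult_left_mono) auto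
      finally have small: "norm (x (Suc i) - x i) \<le> \<eta> * (1 - norm (x i))" .
      have pos: "0 < 1 - norm (x i)" using x_in[OF i] \<tau> by simp
      have "norm (f (x (Suc i)) - f (x i)) \<le> C1 * d (x i) * (norm (x (Suc i) - x i) / (1 - norm (x i)))"
        by (rule upper[OF x_disk[OF i] small])
      also have "\<dots> \<le> C1 * d (x i) * 1"
      proof (intro mult_left_mono)
        show "norm (x (Suc i) - x i) / (1 - norm (x i)) \<le> 1"
        proof -
          have "\<eta> * (1 - norm (x i)) \<le> 1 * (1 - norm (x i))"
            using \<eta> pos by (intro mult_right_mono) auto
          then have "norm (x (Suc i) - x i) \<le> 1 - norm (x i)" using order_trans[OF small] by simp
          then show ?thesis using pos by (simp only: divide_le_eq_1) simp
        qed
      qed (use C1_nonneg d_pos[OF x_disk[OF i]] in auto)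
      also have "\<dots> \<le> C1 * ((1 + C1) ^ i * d a)" using dx C1_nonneg by (simp add: mult_left_mono)
      finally have "norm (f (x (Suc i)) - f a) \<le> C1 * ((1 + C1) ^ i * d a) + ((1 + C1) ^ i - 1) * d a"
        using IH norm_triangle_ineq[of "f (x (Suc i)) - f (x i)" "f (x i) - f a"] by simp
      then show ?case by (simp add: algebra_simps)
    qed
    from this[of n] show ?thesis using n(1) by (simp add: x_def)
  qed
  show thesis
    by (rule that[of "(1 + C1) ^ n - 1"]) (use C1_nonneg est one_le_power[of "1 + C1" n] in auto)
qed

end

context Whitney_John begin

text \<open>
  Let \<open>s\<close> be the distance of the two points and \<open>r = |z|\<close>. If \<open>s \<ge> 1 - r\<close>, both images are within a multiple of \<open>d z\<close> of
  \<open>f z\<close>. Otherwise a point of modulus above \<open>t = 1 - s\<close> is pulled back radially to modulus \<open>t\<close>, which costs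
  at most \<open>c * d\<close> there; the resulting points \<open>a\<close> and \<open>b\<close> are at distance at most \<open>3 s\<close>. If \<open>1 - |a|\<close> is
  comparable to \<open>s\<close>, a chain of boundedly many steps connects them; if it is much larger, the linear
  estimate near \<open>a\<close> applies, and is stronger than the one with exponent \<open>\<delta> < 1\<close>. In all cases \<open>radial_decay\<close> bounds the
  values of \<open>d\<close> by \<open>d z\<close>.
\<close>

lemma oscillation_on_Bset:
  obtains C \<delta> where "0 < C" "0 < \<delta>" "\<delta> < 1"
    "\<And>z \<zeta>1 \<zeta>2. z \<in> unit_disk \<Longrightarrow> \<zeta>1 \<in> Bset z \<Longrightarrow> \<zeta>2 \<in> Bset z \<Longrightarrow>
       norm (f \<zeta>1 - f \<zeta>2) \<le> C * d z * (norm (\<zeta>1 - \<zeta>2) / (1 - norm z)) powr \<delta>"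
proof -
  obtain M \<delta> where M: "0 < M" and \<delta>: "0 < \<delta>" "\<delta> < 1"
    and decay: "\<And>e r \<rho>. norm e = 1 \<Longrightarrow> 0 \<le> r \<Longrightarrow> r \<le> \<rho> \<Longrightarrow> \<rho> < 1 \<Longrightarrow>
       d (of_real \<rho> * e) \<le> M * ((1 - \<rho>) / (1 - r)) powr \<delta> * d (of_real r * e)"
    using radial_decay by blast
  obtain B1 where B1: "0 \<le> B1" and H1: "\<And>\<tau> a b. 0 < \<tau> \<Longrightarrow> norm a \<le> 1 - \<tau> \<Longrightarrow> norm b \<le> 1 - \<tau>
      \<Longrightarrow> norm (a - b) \<le> pi * \<tau> \<Longrightarrow> norm (f b - f a) \<le> B1 * d a"
    using Harnack by blast
  obtain B2 where B2: "0 \<le> B2" and H2: "\<And>\<tau> a b. 0 < \<tau> \<Longrightarrow> norm a \<le> 1 - \<tau> \<Longrightarrow> norm b \<le> 1 - \<tau>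
      \<Longrightarrow> norm (a - b) \<le> 3 * \<tau> \<Longrightarrow> norm (f b - f a) \<le> B2 * d a"
    using Harnack by blast
  define N where "N = M * (1 + B1)"
  define E where "E = c * (1 + B1) + B1"
  define C where "C = 2 * E + 2 * c * N + 3 * C1 * N + B2 * N * (3 / \<eta>) + 1"
  have N: "0 \<le> N" and E: "0 \<le> E" using M B1 c_nonneg by (auto simp: N_def E_def)
  have C: "2 * E \<le> C" "2 * c * N + 3 * C1 * N \<le> C" "2 * c * N + B2 * N * (3 / \<eta>) \<le> C" "0 < C"
  proof -
    have "0 \<le> c * N" "0 \<le> C1 * N" "0 \<le> B2 * N * (3 / \<eta>)"
      using N c_nonneg C1_nonneg B2 \<eta> by simp_all
    then show "2 * E \<le> C" "2 * c * N + 3 * C1 * N \<le> C" "2 * c * N + B2 * N * (3 / \<eta>) \<le> C" "0 < C"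
      using E unfolding C_def by linarith+
  qed
  have est: "norm (f \<zeta>1 - f \<zeta>2) \<le> C * d z * (norm (\<zeta>1 - \<zeta>2) / (1 - norm z)) powr \<delta>"
    if z: "z \<in> unit_disk" and \<zeta>: "\<zeta>1 \<in> Bset z" "\<zeta>2 \<in> Bset z" for z \<zeta>1 \<zeta>2
  proof -
    define r where "r = norm z"
    define s where "s = norm (\<zeta>1 - \<zeta>2)"
    define \<rho>1 where "\<rho>1 = norm \<zeta>1"
    define \<rho>2 where "\<rho>2 = norm \<zeta>2"
    obtain e1 where e1: "norm e1 = 1" "\<zeta>1 = of_real \<rho>1 * e1" "r \<le> \<rho>1" "\<rho>1 < 1"
        "norm (of_real r * e1 - z) \<le> pi * (1 - r)"
      using Bset_polar[OF z \<zeta>(1)] unfolding r_def \<rho>1_def by blast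
    obtain e2 where e2: "norm e2 = 1" "\<zeta>2 = of_real \<rho>2 * e2" "r \<le> \<rho>2" "\<rho>2 < 1"
        "norm (of_real r * e2 - z) \<le> pi * (1 - r)"
      using Bset_polar[OF z \<zeta>(2)] unfolding r_def \<rho>2_def by blast
    have r: "0 \<le> r" "r < 1" using z by (auto simp: r_def)
    have dz: "0 < d z" by (rule d_pos[OF z])
    define x where "x = (s / (1 - r)) powr \<delta>"
    have x0: "0 \<le> x" by (simp add: x_def)
    have near: "norm (f (of_real r * e) - f z) \<le> B1 * d z" "d (of_real r * e) \<le> (1 + B1) * d z"
      if e: "norm e = 1" "norm (of_real r * e - z) \<le> pi * (1 - r)" for e
    proof -
      show *: "norm (f (of_real r * e) - f z) \<le> B1 * d z"
        by (rule H1[of "1 - r"]) (use e r in \<open>auto simp: norm_mult r_def[symmetric] norm_minus_commute\<close>)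
      have "d (of_real r * e) \<le> d z + norm (f (of_real r * e) - f z)"
        by (rule d_lipschitz[OF z]) (use e r in \<open>simp add: norm_mult\<close>)
      then show "d (of_real r * e) \<le> (1 + B1) * d z" using * by (simp add: algebra_simps)
    qed
    have d_le: "d (of_real \<rho> * e) \<le> N * d z * ((1 - \<rho>) / (1 - r)) powr \<delta>"
      if e: "norm e = 1" "norm (of_real r * e - z) \<le> pi * (1 - r)" and \<rho>: "r \<le> \<rho>" "\<rho> < 1" for e \<rho>
    proof -
      have "d (of_real \<rho> * e) \<le> M * ((1 - \<rho>) / (1 - r)) powr \<delta> * d (of_real r * e)"
        by (rule decay[OF e(1) r(1) \<rho>])
      also have "\<dots> \<le> M * ((1 - \<rho>) / (1 - r)) powr \<delta> * ((1 + B1) * d z)"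
        using M near(2)[OF e] by (intro mult_left_mono) auto
      finally show ?thesis by (simp add: N_def mult_ac)
    qed
    have "norm (f \<zeta>1 - f \<zeta>2) \<le> C * d z * x"
    proof (cases "1 - r \<le> s")
      case True
      have far: "norm (f (of_real \<rho> * e) - f z) \<le> E * d z"
        if e: "norm e = 1" "norm (of_real r * e - z) \<le> pi * (1 - r)" and \<rho>: "r \<le> \<rho>" "\<rho> < 1" for e \<rho>
      proof -
        have "norm (f (of_real \<rho> * e) - f (of_real r * e)) \<le> c * d (of_real r * e)"
          by (rule radial_oscillation[OF e(1) r(1) \<rho>])
        also have "\<dots> \<le> c * ((1 + B1) * d z)" using near(2)[OF e] c_nonneg by (rule mult_left_mono)
        finally have "norm (f (of_real \<rho> * e) - f z) \<le> c * ((1 + B1) * d z) + B1 * d z"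
          using near(1)[OF e] norm_triangle_ineq[of "f (of_real \<rho> * e) - f (of_real r * e)" "f (of_real r * e) - f z"]
          by simp
        then show ?thesis by (simp add: E_def algebra_simps)
      qed
      have "1 \<le> s / (1 - r)" using True r by simp
      then have "1 \<le> x" unfolding x_def using \<delta> by (simp add: ge_one_powr_ge_zero)
      have "norm (f \<zeta>1 - f \<zeta>2) \<le> norm (f \<zeta>1 - f z) + norm (f \<zeta>2 - f z)"
        using norm_triangle_ineq4[of "f \<zeta>1 - f z" "f \<zeta>2 - f z"] by simp
      also have "\<dots> \<le> 2 * E * d z * 1"
        using far[OF e1(1,5,3,4)] far[OF e2(1,5,3,4)] by (simp add: e1(2)[symmetric] e2(2)[symmetric])
      also have "\<dots> \<le> C * d z * x"
        using \<open>1 \<le> x\<close> C dz E by (intro mult_mono) auto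
      finally show ?thesis .
    next
      case False
      show ?thesis
      proof (cases "s = 0")
        case True
        then show ?thesis using C dz x0 by (simp add: s_def)
      next
        case s_nz: False
        then have s: "0 < s" "s < 1 - r" using False by (auto simp: s_def)
        define t where "t = 1 - s"
        have t: "r \<le> t" "t < 1" using s by (auto simp: t_def)
        have pull: "norm (f (of_real \<rho> * e) - f (of_real (min \<rho> t) * e)) \<le> c * N * d z * x"
            "norm (of_real \<rho> * e - of_real (min \<rho> t) * e) \<le> s"
          if e: "norm e = 1" "norm (of_real r * e - z) \<le> pi * (1 - r)" and \<rho>: "r \<le> \<rho>" "\<rho> < 1" for e \<rho>
        proof -
          show "norm (f (of_real \<rho> * e) - f (of_real (min \<rho> t) * e)) \<le> c * N * d z * x"
          proof (cases "\<rho> \<le> t")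
            case True
            then show ?thesis using c_nonneg N dz x0 by simp
          next
            case False
            then have "norm (f (of_real \<rho> * e) - f (of_real (min \<rho> t) * e)) \<le> c * d (of_real t * e)"
              using radial_oscillation[OF e(1), of t \<rho>] t r \<rho> by simp
            also have "\<dots> \<le> c * (N * d z * ((1 - t) / (1 - r)) powr \<delta>)"
              by (intro mult_left_mono d_le e t c_nonneg)
            finally show ?thesis by (simp add: t_def x_def mult_ac)
          qed
          have "norm (of_real \<rho> * e - of_real (min \<rho> t) * e) = \<bar>\<rho> - min \<rho> t\<bar>"
            using e(1) by (metis left_diff_distrib norm_mult norm_of_real of_real_diff mult.right_neutral)
          then show "norm (of_real \<rho> * e - of_real (min \<rho> t) * e) \<le> s"
            using \<rho> s by (simp add: t_def min_def)
        qed
        define \<rho>' where "\<rho>' = min \<rho>1 t"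
        define a where "a = of_real \<rho>' * e1"
        define b where "b = of_real (min \<rho>2 t) * e2"
        have \<rho>': "r \<le> \<rho>'" "\<rho>' < 1" "s \<le> 1 - \<rho>'" using t e1 by (auto simp: \<rho>'_def t_def)
        have norm_a: "norm a = \<rho>'" using e1(1) \<rho>' r by (simp add: a_def norm_mult)
        have norm_b: "norm b \<le> 1 - s" using e2 t r by (simp add: b_def norm_mult t_def)
        have a: "a \<in> unit_disk" using norm_a \<rho>' by simp
        have fa: "norm (f \<zeta>1 - f a) \<le> c * N * d z * x" and \<zeta>a: "norm (\<zeta>1 - a) \<le> s"
          using pull[OF e1(1,5,3,4)] by (simp_all add: a_def \<rho>'_def e1(2)[symmetric])
        have fb: "norm (f \<zeta>2 - f b) \<le> c * N * d z * x" and \<zeta>b: "norm (\<zeta>2 - b) \<le> s"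
          using pull[OF e2(1,5,3,4)] by (simp_all add: b_def e2(2)[symmetric])
        have ab: "norm (a - b) \<le> 3 * s"
        proof -
          have "a - b = (\<zeta>1 - \<zeta>2) - (\<zeta>1 - a) + (\<zeta>2 - b)" by simp
          then have "norm (a - b) \<le> norm (\<zeta>1 - \<zeta>2) + norm (\<zeta>1 - a) + norm (\<zeta>2 - b)"
            by (smt (verit) norm_triangle_ineq norm_triangle_ineq4)
          then show ?thesis using \<zeta>a \<zeta>b by (simp add: s_def)
        qed
        define X where "X = (1 - \<rho>') / (1 - r)"
        have X: "0 < X" using \<rho>' r by (simp add: X_def)
        have da: "d a \<le> N * d z * X powr \<delta>"
          unfolding a_def X_def by (rule d_le[OF e1(1,5) \<rho>'(1,2)])
        have middle: "norm (f b - f a) \<le> (3 * C1 * N) * d z * x \<or> norm (f b - f a) \<le> (B2 * N * (3 / \<eta>)) * d z * x"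
        proof (cases "3 * s \<le> \<eta> * (1 - \<rho>')")
          case True
          define y where "y = 3 * s / (1 - \<rho>')"
          have y: "0 \<le> y" "y \<le> 1"
          proof -
            have "\<eta> * (1 - \<rho>') \<le> 1 * (1 - \<rho>')" using \<eta> \<rho>' by (intro mult_right_mono) auto
            then have "3 * s \<le> 1 - \<rho>'" using order_trans[OF True] by simp
            then show "0 \<le> y" "y \<le> 1" using s \<rho>' by (auto simp: y_def)
          qed
          have "norm (f b - f a) \<le> C1 * d a * (norm (b - a) / (1 - norm a))"
            by (rule upper[OF a]) (use ab True in \<open>simp add: norm_a norm_minus_commute\<close>)
          also have "\<dots> \<le> C1 * d a * y"
            using ab \<rho>' C1_nonneg d_pos[OF a] unfolding y_def norm_a
            by (intro mult_left_mono divide_right_mono) (auto simp: norm_minus_commute)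
          also have "\<dots> \<le> C1 * (N * d z * X powr \<delta>) * y powr \<delta>"
            using da C1_nonneg d_pos[OF a] y \<delta> le_powr_of_le_1[of y \<delta>] N dz
            by (intro mult_mono mult_left_mono) auto
          also have "\<dots> = C1 * N * d z * (X * y) powr \<delta>"
            using X y by (simp add: powr_mult)
          also have "X * y = 3 * (s / (1 - r))" using \<rho>' by (simp add: X_def y_def)
          also have "(3 * (s / (1 - r))) powr \<delta> = 3 powr \<delta> * x"
            unfolding x_def by (rule powr_mult)
          also have "C1 * N * d z * (3 powr \<delta> * x) \<le> C1 * N * d z * (3 * x)"
            using C1_nonneg N dz x0 powr_le_of_ge_1[of 3 \<delta>] \<delta> by (intro mult_left_mono mult_right_mono) auto
          finally show ?thesis by (simp add: mult_ac)
        next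
          case False
          have "norm (f b - f a) \<le> B2 * d a"
            by (rule H2[of s]) (use s norm_a norm_b \<rho>' ab in auto)
          also have "\<dots> \<le> B2 * (N * d z * X powr \<delta>)" by (rule mult_left_mono[OF da B2])
          also have "\<dots> \<le> B2 * (N * d z * (3 / \<eta> * x))"
          proof (intro mult_left_mono)
            have "1 - \<rho>' \<le> 3 / \<eta> * s" using False \<eta> by (simp add: field_simps)
            then have "X \<le> 3 / \<eta> * s / (1 - r)" unfolding X_def using r by (intro divide_right_mono) auto
            then have "X powr \<delta> \<le> (3 / \<eta> * (s / (1 - r))) powr \<delta>"
              using X \<delta> by (intro powr_mono2) auto
            also have "\<dots> = (3 / \<eta>) powr \<delta> * x"
              unfolding x_def by (rule powr_mult)
            also have "\<dots> \<le> 3 / \<eta> * x"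
              using \<eta> \<delta> x0 by (intro mult_right_mono powr_le_of_ge_1) auto
            finally show "X powr \<delta> \<le> 3 / \<eta> * x" .
          qed (use B2 N dz in auto)
          finally show ?thesis by (simp add: mult_ac)
        qed
        have "norm (f \<zeta>1 - f \<zeta>2) \<le> norm (f \<zeta>1 - f a) + norm (f b - f a) + norm (f \<zeta>2 - f b)"
        proof -
          have "f \<zeta>1 - f \<zeta>2 = (f \<zeta>1 - f a) - (f b - f a) - (f \<zeta>2 - f b)" by simp
          then show ?thesis by (smt (verit) norm_triangle_ineq4)
        qed
        also have "\<dots> \<le> c * N * d z * x + norm (f b - f a) + c * N * d z * x"
          using fa fb by linarith
        also have "\<dots> \<le> max (2 * c * N + 3 * C1 * N) (2 * c * N + B2 * N * (3 / \<eta>)) * (d z * x)"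
        proof -
          have dx: "0 \<le> d z * x" using dz x0 by simp
          show ?thesis using middle
          proof
            assume "norm (f b - f a) \<le> (3 * C1 * N) * d z * x"
            then have "c * N * d z * x + norm (f b - f a) + c * N * d z * x
                \<le> (2 * c * N + 3 * C1 * N) * (d z * x)" by (simp add: algebra_simps)
            also have "\<dots> \<le> max (2 * c * N + 3 * C1 * N) (2 * c * N + B2 * N * (3 / \<eta>)) * (d z * x)"
              using dx by (intro mult_right_mono) auto
            finally show ?thesis .
          next
            assume "norm (f b - f a) \<le> (B2 * N * (3 / \<eta>)) * d z * x"
            then have "c * N * d z * x + norm (f b - f a) + c * N * d z * x
                \<le> (2 * c * N + B2 * N * (3 / \<eta>)) * (d z * x)" by (simp add: algebra_simps)
            also have "\<dots> \<le> max (2 * c * N + 3 * C1 * N) (2 * c * N + B2 * N * (3 / \<eta>)) * (d z * x)"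
              using dx by (intro mult_right_mono) auto
            finally show ?thesis .
          qed
        qed
        also have "\<dots> \<le> C * (d z * x)"
          using C dz x0 by (intro mult_right_mono) auto
        finally show ?thesis by (simp add: mult_ac)
      qed
    qed
    then show ?thesis by (simp add: x_def s_def r_def)
  qed
  show thesis by (rule that[OF C(4) \<delta> est])
qed

end

section \<open>Harmonic quasiconformal maps onto radial John disks\<close>

text \<open>
  Where the distortion inequality holds it reads \<open>|h'| + |g'| \<le> K (|h'| - |g'|)\<close>, that is
  \<open>|g'| \<le> k |h'|\<close> with \<open>k = (K - 1) / (K + 1)\<close>. The set where this fails is open and a null set, hence empty.
\<close>

lemma harmonic_qc_disk_of_S_H0_qc:
  assumes "f \<in> S_H0_qc K \<Omega>"
  obtains h g k where "harmonic_qc_disk f h g k"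
proof -
  obtain h g where rep: "harmonic_univalent_rep f h g" and qc: "quasiconformal_on K unit_disk f"
    using assms by (auto simp: S_H0_qc_def S_H0_def)
  have holo: "h holomorphic_on unit_disk" "g holomorphic_on unit_disk"
    and f_eq: "\<And>z. z \<in> unit_disk \<Longrightarrow> f z = h z + cnj (g z)"
    and inj: "inj_on f unit_disk"
    and J: "\<And>z. z \<in> unit_disk \<Longrightarrow> 0 < (norm (deriv h z))\<^sup>2 - (norm (deriv g z))\<^sup>2"
    using rep by (auto simp: harmonic_univalent_rep_def)
  define k where "k = (K - 1) / (K + 1)"
  have K: "1 \<le> K" using qc by (simp add: quasiconformal_on_def)
  have pointwise: "norm (deriv g z) \<le> k * norm (deriv h z)"
    if z: "z \<in> unit_disk" and le: "(D_norm f z)\<^sup>2 \<le> K * \<bar>D_det f z\<bar>" for z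
  proof -
    define \<alpha> where "\<alpha> = deriv h z"
    define \<beta> where "\<beta> = deriv g z"
    have "(f has_derivative (\<lambda>v. \<alpha> * v + cnj (\<beta> * v))) (at z)"
      unfolding \<alpha>_def \<beta>_def by (rule has_derivative_harmonic[OF holo f_eq z])
    then have fd: "frechet_derivative f (at z) = (\<lambda>v. \<alpha> * v + cnj (\<beta> * v))"
      by (simp add: frechet_derivative_at[symmetric])
    have dx: "dx f z = \<alpha> + cnj \<beta>" and dy: "dy f z = \<i> * (\<alpha> - cnj \<beta>)"
      by (simp_all add: dx_def dy_def fd algebra_simps)
    have "dz f z = \<alpha>" "dzbar f z = cnj \<beta>"
      by (simp_all add: dz_def dzbar_def dx dy complex_eq_iff)
    then have D: "D_norm f z = norm \<alpha> + norm \<beta>" by (simp add: D_norm_def)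
    have "D_det f z = (norm \<alpha>)\<^sup>2 - (norm \<beta>)\<^sup>2"
      unfolding cmod_power2 by (simp add: D_det_def dx dy power2_eq_square algebra_simps)
    then have "\<bar>D_det f z\<bar> = (norm \<alpha> + norm \<beta>) * (norm \<alpha> - norm \<beta>)"
      using J[OF z] by (simp add: \<alpha>_def \<beta>_def power2_eq_square algebra_simps)
    then have "(norm \<alpha> + norm \<beta>) * (norm \<alpha> + norm \<beta>) \<le> (norm \<alpha> + norm \<beta>) * (K * (norm \<alpha> - norm \<beta>))"
      using le by (simp add: D power2_eq_square mult_ac)
    moreover have "0 < norm \<alpha> + norm \<beta>"
      using J[OF z] by (cases "\<alpha> = 0") (auto simp: \<alpha>_def \<beta>_def add_pos_nonneg)
    ultimately have "norm \<alpha> + norm \<beta> \<le> K * (norm \<alpha> - norm \<beta>)" by simp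
    then have "(K + 1) * norm \<beta> \<le> (K - 1) * norm \<alpha>" by (simp add: algebra_simps)
    then show ?thesis using K by (simp add: k_def \<alpha>_def \<beta>_def field_simps)
  qed
  define V where "V = {z \<in> unit_disk. 0 < norm (deriv g z) - k * norm (deriv h z)}"
  have "open V"
  proof -
    have "continuous_on unit_disk (\<lambda>z. norm (deriv g z) - k * norm (deriv h z))"
      by (intro continuous_intros holomorphic_on_imp_continuous_on holomorphic_deriv holo) auto
    from continuous_open_preimage[OF this open_ball open_greaterThan[of 0]]
    show ?thesis by (simp add: V_def vimage_def Int_def conj_commute)
  qed
  moreover have "negligible V"
  proof -
    have "AE z in lebesgue. z \<in> unit_disk \<longrightarrow> (D_norm f z)\<^sup>2 \<le> K * \<bar>D_det f z\<bar>"
      using qc by (auto simp: quasiconformal_on_def)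
    then have "AE z in lebesgue. z \<notin> V"
      by (rule AE_mp) (use pointwise in \<open>fastforce simp: V_def\<close>)
    then have "V \<in> null_sets lebesgue"
      using AE_iff_null_sets[of V lebesgue] \<open>open V\<close> by auto
    then show ?thesis by (simp add: negligible_iff_null_sets)
  qed
  ultimately have "V = {}" using open_not_negligible by blast
  have dil: "norm (deriv g z) \<le> k * norm (deriv h z)" if "z \<in> unit_disk" for z
  proof (rule ccontr)
    assume "\<not> ?thesis"
    then have "z \<in> V" using that by (simp add: V_def)
    with \<open>V = {}\<close> show False by blast
  qed
  have "harmonic_qc_disk f h g k"
  proof
    show "deriv h z \<noteq> 0" if "z \<in> unit_disk" for z using J[OF that] by auto
    show "0 \<le> k" "k < 1" using K by (auto simp: k_def)
  qed (use holo f_eq inj dil in auto)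
  then show thesis by (rule that)
qed

text \<open>
  The division points up to index \<open>n\<close> are scaled to a partition of the subarc that starts at \<open>R 0\<close>. The
  outer end point \<open>\<rho>\<close> is chosen strictly beyond \<open>R n\<close> so that the subarc does not degenerate.
\<close>

lemma John_partition_sum_le:
  assumes John: "radial_c_John_disk c f \<Omega>" and e: "norm e = 1" and R: "mono R" "range R \<subseteq> {0..<1}"
  shows "(\<Sum>i<n. norm (f (of_real (R (Suc i)) * e) - f (of_real (R i) * e)))
    \<le> c * bdist \<Omega> (f (of_real (R 0) * e))"
proof -
  define \<rho> where "\<rho> = (R n + 1) / 2"
  have R_range: "0 \<le> R i" "R i < 1" for i using R(2) by (auto simp: subset_iff)
  have \<rho>: "0 < \<rho>" "\<rho> < 1" "R n < \<rho>" using R_range[of n] by (auto simp: \<rho>_def)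
  define z where "z = of_real \<rho> * e"
  define \<gamma> where "\<gamma> = f \<circ> linepath 0 z"
  define s where "s = R 0 / \<rho>"
  have z: "z \<in> unit_disk" using \<rho> e by (simp add: z_def norm_mult)
  have R_mono: "R 0 \<le> R (min i n)" "R (min i n) \<le> R n" for i
    using R(1) by (auto simp: mono_def)
  have s: "0 \<le> s" "s < 1"
    using R_range[of 0] R_mono[of n] \<rho> by (auto simp: s_def)
  have \<gamma>: "\<gamma> (u / \<rho>) = f (of_real u * e)" for u
    using \<rho> by (simp add: \<gamma>_def linepath_def z_def scaleR_conv_of_real)
  have len: "path_length (subpath s 1 \<gamma>) \<le> ennreal (c * bdist \<Omega> (\<gamma> s))"
    using John z s unfolding radial_c_John_disk_def \<gamma>_def Let_def by auto
  define t where "t i = (R (min i n) / \<rho> - s) / (1 - s)" for i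
  have t_sub: "subpath s 1 \<gamma> (t i) = f (of_real (R (min i n)) * e)" for i
  proof -
    have "(1 - s) * t i + s = R (min i n) / \<rho>"
      using s by (simp add: t_def)
    then show ?thesis by (simp add: subpath_def \<gamma>)
  qed
  have "mono t"
    unfolding mono_def t_def using s \<rho> R(1)
    by (auto intro!: divide_right_mono simp: mono_def min_le_iff_disj)
  moreover have "range t \<subseteq> {0..1}"
  proof -
    have "0 \<le> t i \<and> t i \<le> 1" for i
    proof -
      have le: "s \<le> R (min i n) / \<rho>" "R (min i n) / \<rho> \<le> 1"
        using R_mono[of i] \<rho> by (auto simp: s_def divide_right_mono)
      then show ?thesis using s by (simp add: t_def)
    qed
    then show ?thesis by auto
  qed
  ultimately have "ennreal (\<Sum>i<n. dist (subpath s 1 \<gamma> (t i)) (subpath s 1 \<gamma> (t (Suc i))))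
      \<le> path_length (subpath s 1 \<gamma>)"
    unfolding path_length_def by (intro SUP_upper2[of "(n, t)"]) auto
  also have "\<dots> \<le> ennreal (c * bdist \<Omega> (\<gamma> s))" by (rule len)
  finally have "(\<Sum>i<n. dist (subpath s 1 \<gamma> (t i)) (subpath s 1 \<gamma> (t (Suc i)))) \<le> c * bdist \<Omega> (\<gamma> s)"
    using John by (subst (asm) ennreal_le_iff)
      (auto simp: radial_c_John_disk_def bdist_def infdist_nonneg)
  moreover have "(\<Sum>i<n. dist (subpath s 1 \<gamma> (t i)) (subpath s 1 \<gamma> (t (Suc i))))
      = (\<Sum>i<n. norm (f (of_real (R (Suc i)) * e) - f (of_real (R i) * e)))"
    by (intro sum.cong) (auto simp: t_sub dist_norm norm_minus_commute min_def)
  ultimately show ?thesis by (simp add: s_def \<gamma>)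
qed

lemma bdist_pos:
  assumes "open \<Omega>" "bounded \<Omega>" "w \<in> \<Omega>"
  shows "frontier \<Omega> \<noteq> {}" "0 < bdist \<Omega> w" "ball w (bdist \<Omega> w) \<subseteq> \<Omega>"
proof -
  have "\<Omega> \<noteq> {}" "\<Omega> \<noteq> UNIV" using assms not_bounded_UNIV by auto
  then show fr: "frontier \<Omega> \<noteq> {}" by (simp add: frontier_eq_empty)
  have "w \<notin> frontier \<Omega>" using assms by (simp add: frontier_def interior_open)
  then show "0 < bdist \<Omega> w"
    unfolding bdist_def using fr frontier_closed[of \<Omega>]
    by (metis in_closed_iff_infdist_zero infdist_nonneg less_eq_real_def)
  then have "w \<in> ball w (bdist \<Omega> w) \<inter> \<Omega>" using assms by simp
  then have ne: "ball w (bdist \<Omega> w) \<inter> \<Omega> \<noteq> {}" by blast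
  show "ball w (bdist \<Omega> w) \<subseteq> \<Omega>"
  proof (rule ccontr)
    assume "\<not> ball w (bdist \<Omega> w) \<subseteq> \<Omega>"
    then have "ball w (bdist \<Omega> w) - \<Omega> \<noteq> {}" by blast
    from connected_Int_frontier[OF connected_ball ne this]
    obtain y where "y \<in> frontier \<Omega>" "dist w y < bdist \<Omega> w" by auto
    then show False using infdist_le[of y "frontier \<Omega>" w] by (simp add: bdist_def)
  qed
qed

lemma le_bdist:
  assumes "open \<Omega>" "bounded \<Omega>" "w \<in> \<Omega>" "ball w m \<subseteq> \<Omega>"
  shows "m \<le> bdist \<Omega> w"
proof -
  have "m \<le> dist w y" if "y \<in> frontier \<Omega>" for y
  proof -
    have "y \<notin> \<Omega>" using that assms(1) by (simp add: frontier_def interior_open)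
    then show ?thesis using assms(4) by (auto simp: subset_iff not_less[symmetric])
  qed
  then show ?thesis
    unfolding bdist_def using bdist_pos(1)[OF assms(1-3)]
    by (simp add: infdist_notempty cINF_greatest)
qed

text \<open>
  All assumptions follow from the John condition, the distortion on disks of radius \<open>\<eta> (1 - |z|)\<close>, and the
  comparison of \<open>d\<close> with \<open>(1 - |z|) |h'|\<close>.
\<close>

lemma (in harmonic_qc_disk) Whitney_John_of_radial_John:
  assumes John: "radial_c_John_disk c f \<Omega>"
  obtains \<eta> C1 c2 where "Whitney_John f (\<lambda>z. bdist \<Omega> (f z)) \<eta> C1 c2 c"
proof -
  obtain \<eta> where \<eta>: "0 < \<eta>" "\<eta> \<le> 1/2"
    and up: "\<And>z \<zeta>. z \<in> unit_disk \<Longrightarrow> norm (\<zeta> - z) \<le> \<eta> * (1 - norm z) \<Longrightarrow>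
       norm (f \<zeta> - f z) \<le> 4 * norm (deriv h z) * norm (\<zeta> - z)"
    and lo: "\<And>z \<zeta>. z \<in> unit_disk \<Longrightarrow> norm (\<zeta> - z) \<le> \<eta> * (1 - norm z) \<Longrightarrow>
       (1 - k) / 2 * norm (deriv h z) * norm (\<zeta> - z) \<le> norm (f \<zeta> - f z)"
    using Whitney_distortion by blast
  have \<Omega>: "\<Omega> = f ` unit_disk" "open \<Omega>" "bounded \<Omega>" and c: "1 \<le> c"
    using John by (auto simp: radial_c_John_disk_def)
  define m where "m = (1 - k) / 2 * \<eta>"
  have m: "0 < m" using k_less_1 \<eta> by (simp add: m_def)
  have d_ge: "m * norm (deriv h z) * (1 - norm z) \<le> bdist \<Omega> (f z)" if z: "z \<in> unit_disk" for z
  proof (rule le_bdist[OF \<Omega>(2,3)])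
    show "f z \<in> \<Omega>" using z \<Omega> by auto
    let ?r = "\<eta> * (1 - norm z)"
    have sub: "cball z ?r \<subseteq> unit_disk"
    proof
      fix x assume "x \<in> cball z ?r"
      then have "norm x \<le> norm z + \<eta> * (1 - norm z)"
        using norm_triangle_sub[of x z] by (simp add: dist_norm norm_minus_commute)
      also have "\<dots> < norm z + 1 * (1 - norm z)"
        using \<eta> z by (intro add_strict_left_mono mult_strict_right_mono) auto
      finally show "x \<in> unit_disk" by simp
    qed
    have "ball (f z) (m * norm (deriv h z) * (1 - norm z)) \<subseteq> f ` ball z ?r"
    proof (rule ball_subset_image_ball)
      show "continuous_on (cball z ?r) f" using continuous_f sub continuous_on_subset by blast
      show "inj_on f (cball z ?r)" using inj sub inj_on_subset by blast
      show "0 < ?r" using \<eta> z by simp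
      show "m * norm (deriv h z) * (1 - norm z) \<le> dist (f z) (f \<zeta>)" if "\<zeta> \<in> sphere z ?r" for \<zeta>
      proof -
        have "norm (\<zeta> - z) = ?r" using that by (simp add: dist_norm norm_minus_commute)
        then show ?thesis using lo[OF z, of \<zeta>] by (simp add: m_def dist_norm norm_minus_commute mult_ac)
      qed
    qed
    then show "ball (f z) (m * norm (deriv h z) * (1 - norm z)) \<subseteq> \<Omega>"
      using sub \<Omega> ball_subset_cball[of z ?r] by blast
  qed
  have d_le: "bdist \<Omega> (f z) \<le> 4 * (1 - norm z) * norm (deriv h z)" if z: "z \<in> unit_disk" for z
  proof -
    have "f z \<in> \<Omega>" using z \<Omega> by auto
    then have "bdist \<Omega> (f z) \<le> 2 * (1 - (norm z)\<^sup>2) * norm (deriv h z)"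
      using image_ball_radius_le[OF z, of "bdist \<Omega> (f z)"] bdist_pos(3)[OF \<Omega>(2,3)] \<Omega>(1) by simp
    also have "\<dots> \<le> 2 * (2 * (1 - norm z)) * norm (deriv h z)"
    proof -
      have "1 - (norm z)\<^sup>2 = (1 + norm z) * (1 - norm z)" by (simp add: power2_eq_square algebra_simps)
      also have "\<dots> \<le> 2 * (1 - norm z)" using z by (intro mult_right_mono) auto
      finally show ?thesis by (intro mult_right_mono mult_left_mono) auto
    qed
    finally show ?thesis by simp
  qed
  have "Whitney_John f (\<lambda>z. bdist \<Omega> (f z)) \<eta> (4 / m) (m / 4) c"
  proof
    show "0 < bdist \<Omega> (f z)" if "z \<in> unit_disk" for z
      using bdist_pos(2)[OF \<Omega>(2,3)] that \<Omega>(1) by auto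
    show "bdist \<Omega> (f b) \<le> bdist \<Omega> (f a) + norm (f b - f a)" for a b
      unfolding bdist_def using infdist_triangle[of "f b" _ "f a"] by (simp add: dist_norm)
    show "norm (f \<zeta> - f z) \<le> 4 / m * bdist \<Omega> (f z) * (norm (\<zeta> - z) / (1 - norm z))"
      if z: "z \<in> unit_disk" and \<zeta>: "norm (\<zeta> - z) \<le> \<eta> * (1 - norm z)" for z \<zeta>
    proof -
      have "norm (f \<zeta> - f z) \<le> 4 * norm (deriv h z) * norm (\<zeta> - z)" by (rule up[OF z \<zeta>])
      also have "\<dots> = 4 / m * (m * norm (deriv h z) * (1 - norm z)) * (norm (\<zeta> - z) / (1 - norm z))"
        using m z by simp
      also have "\<dots> \<le> 4 / m * bdist \<Omega> (f z) * (norm (\<zeta> - z) / (1 - norm z))"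
        using m z by (intro mult_right_mono mult_left_mono d_ge) auto
      finally show ?thesis .
    qed
    show "m / 4 * bdist \<Omega> (f z) \<le> norm (f \<zeta> - f z)"
      if z: "z \<in> unit_disk" and \<zeta>: "norm (\<zeta> - z) = \<eta> * (1 - norm z)" for z \<zeta>
    proof -
      have "m / 4 * bdist \<Omega> (f z) \<le> m / 4 * (4 * (1 - norm z) * norm (deriv h z))"
        using m by (intro mult_left_mono d_le z) auto
      also have "\<dots> = (1 - k) / 2 * norm (deriv h z) * norm (\<zeta> - z)"
        by (simp add: m_def \<zeta> mult_ac)
      also have "\<dots> \<le> norm (f \<zeta> - f z)" using \<zeta> by (intro lo[OF z]) simp
      finally show ?thesis .
    qed
  qed (use \<eta> m c John_partition_sum_le[OF John] in auto)
  then show thesis by (rule that)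
qed

theorem theorem1p2:
  fixes K :: real and f :: "complex \<Rightarrow> complex" and \<Omega> :: "complex set"
  assumes "K \<ge> 1"
    and "f \<in> S_H0_qc K \<Omega>"
    and "radial_John_disk f \<Omega>"
  shows "\<exists>\<delta> C :: real. 0 < \<delta> \<and> \<delta> < 1 \<and> C > 0 \<and>
    (\<forall>z\<in>unit_disk. \<forall>\<zeta>1\<in>Bset z. \<forall>\<zeta>2\<in>Bset z.
       norm (f \<zeta>1 - f \<zeta>2) \<le> C * bdist \<Omega> (f z) * (norm (\<zeta>1 - \<zeta>2) / (1 - norm z)) powr \<delta>)"
proof -
  obtain h g k where "harmonic_qc_disk f h g k"
    using harmonic_qc_disk_of_S_H0_qc[OF assms(2)] .
  then interpret harmonic_qc_disk f h g k .
  obtain c where "radial_c_John_disk c f \<Omega>"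
    using assms(3) by (auto simp: radial_John_disk_def)
  then obtain \<eta> C1 c2 where "Whitney_John f (\<lambda>z. bdist \<Omega> (f z)) \<eta> C1 c2 c"
    by (rule Whitney_John_of_radial_John)
  then interpret Whitney_John f "\<lambda>z. bdist \<Omega> (f z)" \<eta> C1 c2 c .
  show ?thesis using oscillation_on_Bset by metis
qed

end
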